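(* Let $g$ be a complex hyper-K\"ahler metric on a complex four-manifold $X$ of the form $$g=\eta_{ij}\,dy^i\odot dx^j+\frac{\partial^2\Theta}{\partial y^i\partial y^j}\,dx^i\odot dx^j ,$$ where $\Theta$ satisfies the second heavenly equation, and suppose that the vector field $W=x^i\frac{\partial}{\partial x^i}$ satisfies $\mathcal L_Wg=g$ and $g(W,W)=0$. Then, locally away from the hypersurface $x\cdot y=0$, the metric is given by $$g=\eta_{ij}\,dy^i\odot dx^j+\eta_{kp}\eta_{lq}\,\frac{F\big(\frac{x^1}{x\cdot y},\frac{x^2}{x\cdot y}\big)}{(x\cdot y)^3}\,x^kx^l\,dx^p\odot dx^q ,$$ where $F$ is an arbitrary holomorphic function of two variables and $x\cdot y=\eta_{ij}x^iy^j$.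
   Context: Everything is holomorphic and local. Indices run over $1,2$ with summation over repeated indices; $\eta=(\eta_{ij})=\begin{bmatrix}0&1\\-1&0\end{bmatrix}$, $a\odot b=\frac12(a\otimes b+b\otimes a)$. $(x^1,x^2,y^1,y^2)$ are local coordinates on $X$ and $\Theta(x,y)$ is a holomorphic function satisfying the second heavenly equation $$\frac{\partial^2\Theta}{\partial y^1\partial x^2}-\frac{\partial^2\Theta}{\partial y^2\partial x^1}-\frac{\partial^2\Theta}{\partial (y^1)^2}\frac{\partial^2\Theta}{\partial (y^2)^2}+\Big(\frac{\partial^2\Theta}{\partial y^1\partial y^2}\Big)^2=0 ,$$ which is the condition making the displayed metric complex hyper-K\"ahler in these coordinates. *)

theory Defs
  imports "HOL-Analysis.Analysis"
begin

text \<open>Both notions below are only meaningful for open \<open>U\<close>, respectively for \<open>f\<close>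
  holomorphic near \<open>z\<close>: the derivative is the real Frechet one, required to be complex linear.\<close>

definition holo_on :: "(complex ^ 'n \<Rightarrow> complex) \<Rightarrow> (complex ^ 'n) set \<Rightarrow> bool"
    (infix "holo'_on" 50) where
  "f holo_on U \<longleftrightarrow>
     (\<forall>z\<in>U. \<exists>f'. (f has_derivative f') (at z) \<and> (\<forall>c v. f' (c *s v) = c * f' v))"

definition pd :: "'n \<Rightarrow> (complex ^ 'n \<Rightarrow> complex) \<Rightarrow> complex ^ 'n \<Rightarrow> complex" where
  "pd k f z = deriv (\<lambda>t. f (z + t *s axis k 1)) 0"

text \<open>The coordinate indices are \<open>Inl 1, Inl 2\<close> for \<open>x\<^sup>1, x\<^sup>2\<close> and \<open>Inr 1, Inr 2\<close>
  for \<open>y\<^sup>1, y\<^sup>2\<close>. Tensors at a point are given by their components in the coordinate frame: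
  \<open>g $ a $ b\<close> is \<open>g(\<partial>\<^sub>a, \<partial>\<^sub>b)\<close> for a covariant 2-tensor, and
  \<open>T $ a $ b\<close> is \<open>T\<^sup>a\<^sub>b\<close> for an endomorphism, which acts by \<open>T *v v\<close>.\<close>

type_synonym ix = "2 + 2"
type_synonym pt = "complex ^ ix"
type_synonym tens2 = "complex ^ ix ^ ix"

definition sym_prod :: "pt \<Rightarrow> pt \<Rightarrow> tens2" (infixl "\<odot>" 70) where
  "\<alpha> \<odot> \<beta> = (\<chi> a b. (\<alpha> $ a * \<beta> $ b + \<beta> $ a * \<alpha> $ b) / 2)"

definition dx :: "2 \<Rightarrow> pt" where "dx i = axis (Inl i) 1"
definition dy :: "2 \<Rightarrow> pt" where "dy i = axis (Inr i) 1"

definition apply2 :: "tens2 \<Rightarrow> pt \<Rightarrow> pt \<Rightarrow> complex" where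
  "apply2 h u v = (\<Sum>a\<in>UNIV. \<Sum>b\<in>UNIV. h $ a $ b * u $ a * v $ b)"

definition lie_deriv :: "(pt \<Rightarrow> pt) \<Rightarrow> (pt \<Rightarrow> tens2) \<Rightarrow> pt \<Rightarrow> tens2" where
  "lie_deriv V g z = (\<chi> a b. \<Sum>c\<in>UNIV.
       V z $ c * pd c (\<lambda>w. g w $ a $ b) z
     + g z $ c $ b * pd a (\<lambda>w. V w $ c) z
     + g z $ a $ c * pd b (\<lambda>w. V w $ c) z)"

text \<open>Levi-Civita connection: \<open>christoffel g z a b c\<close> is \<open>\<Gamma>\<^sup>a\<^sub>b\<^sub>c\<close>, and
  \<open>nabla g T z c\<close> is the covariant derivative of the endomorphism field \<open>T\<close> along
  \<open>\<partial>\<^sub>c\<close>.\<close>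

definition christoffel :: "(pt \<Rightarrow> tens2) \<Rightarrow> pt \<Rightarrow> ix \<Rightarrow> ix \<Rightarrow> ix \<Rightarrow> complex" where
  "christoffel g z a b c = (\<Sum>d\<in>UNIV. matrix_inv (g z) $ a $ d *
     (pd b (\<lambda>w. g w $ d $ c) z + pd c (\<lambda>w. g w $ d $ b) z - pd d (\<lambda>w. g w $ b $ c) z)) / 2"

definition nabla :: "(pt \<Rightarrow> tens2) \<Rightarrow> (pt \<Rightarrow> tens2) \<Rightarrow> pt \<Rightarrow> ix \<Rightarrow> tens2" where
  "nabla g T z c = (\<chi> a b. pd c (\<lambda>w. T w $ a $ b) z
     + (\<Sum>d\<in>UNIV. christoffel g z a c d * T z $ d $ b)
     - (\<Sum>d\<in>UNIV. christoffel g z d c b * T z $ a $ d))"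

definition holo_field_on :: "(pt \<Rightarrow> tens2) \<Rightarrow> pt set \<Rightarrow> bool" where
  "holo_field_on T U \<longleftrightarrow> (\<forall>a b. (\<lambda>z. T z $ a $ b) holo_on U)"

definition holo_metric_on :: "(pt \<Rightarrow> tens2) \<Rightarrow> pt set \<Rightarrow> bool" where
  "holo_metric_on g U \<longleftrightarrow> holo_field_on g U \<and>
     (\<forall>z\<in>U. transpose (g z) = g z \<and> invertible (g z))"

text \<open>A complex hyper-Kaehler metric is a holomorphic metric with a parallel, metric-compatible
  action of the quaternions on the holomorphic tangent bundle.\<close>

definition complex_hyperkaehler_on :: "(pt \<Rightarrow> tens2) \<Rightarrow> pt set \<Rightarrow> bool" where
  "complex_hyperkaehler_on g U \<longleftrightarrow> holo_metric_on g U \<and>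
     (\<exists>I J K.
        (\<forall>T\<in>{I, J, K}. holo_field_on T U \<and>
           (\<forall>z\<in>U. T z ** T z = - mat 1 \<and>
                   transpose (T z) ** g z ** T z = g z \<and>
                   (\<forall>c. nabla g T z c = 0))) \<and>
        (\<forall>z\<in>U. I z ** J z = K z))"

definition eta :: "complex ^ 2 ^ 2" where
  "eta = vector [vector [0, 1], vector [-1, 0]]"

definition xdoty :: "pt \<Rightarrow> complex" where
  "xdoty z = (\<Sum>i\<in>UNIV. \<Sum>j\<in>UNIV. eta $ i $ j * z $ Inl i * z $ Inr j)"

definition second_heavenly :: "(pt \<Rightarrow> complex) \<Rightarrow> pt \<Rightarrow> bool" where
  "second_heavenly \<Theta> z \<longleftrightarrow>
     pd (Inr 1) (pd (Inl 2) \<Theta>) z - pd (Inr 2) (pd (Inl 1) \<Theta>) z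
     - pd (Inr 1) (pd (Inr 1) \<Theta>) z * pd (Inr 2) (pd (Inr 2) \<Theta>) z
     + (pd (Inr 1) (pd (Inr 2) \<Theta>) z)\<^sup>2 = 0"

definition heavenly_metric :: "(pt \<Rightarrow> complex) \<Rightarrow> pt \<Rightarrow> tens2" where
  "heavenly_metric \<Theta> z = (\<chi> a b.
     (\<Sum>i\<in>UNIV. \<Sum>j\<in>UNIV. eta $ i $ j * (dy i \<odot> dx j) $ a $ b) +
     (\<Sum>i\<in>UNIV. \<Sum>j\<in>UNIV. pd (Inr i) (pd (Inr j) \<Theta>) z * (dx i \<odot> dx j) $ a $ b))"

definition W :: "pt \<Rightarrow> pt" where
  "W z = (\<Sum>i\<in>UNIV. z $ Inl i *s axis (Inl i) 1)"

definition x_ratio :: "pt \<Rightarrow> complex ^ 2" where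
  "x_ratio z = (\<chi> i. z $ Inl i / xdoty z)"

definition F_metric :: "(complex ^ 2 \<Rightarrow> complex) \<Rightarrow> pt \<Rightarrow> tens2" where
  "F_metric F z = (\<chi> a b.
     (\<Sum>i\<in>UNIV. \<Sum>j\<in>UNIV. eta $ i $ j * (dy i \<odot> dx j) $ a $ b) +
     (\<Sum>k\<in>UNIV. \<Sum>l\<in>UNIV. \<Sum>p\<in>UNIV. \<Sum>q\<in>UNIV.
        eta $ k $ p * eta $ l $ q * (F (x_ratio z) / xdoty z ^ 3)
        * z $ Inl k * z $ Inl l * (dx p \<odot> dx q) $ a $ b))"

end

theory Submission
  imports Defs "HOL-Complex_Analysis.Cauchy_Integral_Formula"
begin

text \<open>Write \<open>H\<close> for the Hessian of \<open>\<Theta>\<close> in \<open>y\<close>, and \<open>h = H(x, _)\<close>. The conditions on \<open>W\<close> say that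
  \<open>H\<close> is homogeneous of degree \<open>-1\<close> along \<open>W\<close> and that \<open>h(x) = 0\<close>. Let \<open>E = x\<^sup>k \<partial>/\<partial>y\<^sup>k\<close>. Differentiating
  \<open>h(x) = 0\<close> in \<open>y\<close> gives \<open>E (det H) = 0\<close>, so the heavenly equation makes the \<open>1\<close>-form \<open>h\<close> closed in \<open>x\<close>;
  differentiating it in \<open>x\<close> then gives \<open>h + W h = 0\<close>, while \<open>W h = 0\<close> by homogeneity. Hence \<open>h = 0\<close>, \<open>H\<close> has
  rank one, and \<open>(x\<cdot>y) H(y, y)\<close> is annihilated by \<open>W\<close> and \<open>E\<close>, that is, it is a function of \<open>x/(x\<cdot>y)\<close>.
  Conversely such an \<open>F\<close> is integrated twice in \<open>x\<cdot>y\<close> to a potential \<open>\<Theta>\<close>, and for every solution \<open>\<Theta>\<close> of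
  the heavenly equation the frame \<open>\<partial>/\<partial>y\<^sup>i\<close>, \<open>\<partial>/\<partial>x\<^sup>i - (\<eta>H)\<^sup>k\<^sub>i \<partial>/\<partial>y\<^sup>k\<close> makes three parallel complex
  structures explicit.\<close>

no_notation fps_nth (infixl "$" 75)

section \<open>Holomorphic functions of several variables\<close>

lemma smult_axis_bounded_linear: "bounded_linear (\<lambda>t::complex. t *s axis k 1 :: complex^'n)"
proof -
  have "linear (\<lambda>t::complex. t *s axis k 1 :: complex^'n)"
    by (rule linearI) (simp_all add: vec_eq_iff algebra_simps axis_def)
  then show ?thesis by (simp add: linear_conv_bounded_linear)
qed

text \<open>A complex-linear Frechet derivative restricts to every complex coordinate line as a
  one-variable complex derivative. At points of holomorphy \<open>deriv\<close> in \<open>pd\<close>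
  is therefore a genuine derivative and not an arbitrary value.\<close>

lemma pd_eqI:
  assumes "(f has_derivative f') (at z)" "\<And>c v. f' (c *s v) = c * f' v"
  shows "((\<lambda>t. f (z + t *s axis k 1)) has_field_derivative f' (axis k 1)) (at 0)"
    and "pd k f z = f' (axis k 1)"
proof -
  have "((\<lambda>t. z + t *s axis k 1) has_derivative (\<lambda>t. t *s axis k 1)) (at 0)"
    by (auto intro!: derivative_eq_intros bounded_linear_imp_has_derivative[OF smult_axis_bounded_linear])
  moreover have "(f has_derivative f') (at (z + 0 *s axis k 1))"
    using assms(1) by simp
  ultimately have "((\<lambda>t. f (z + t *s axis k 1)) has_derivative (\<lambda>t. f' (t *s axis k 1))) (at 0)"
    using has_derivative_compose by blast
  then show *: "((\<lambda>t. f (z + t *s axis k 1)) has_field_derivative f' (axis k 1)) (at 0)"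
    unfolding has_field_derivative_def by (rule has_derivative_eq_rhs) (auto simp: assms(2) mult.commute)
  show "pd k f z = f' (axis k 1)"
    unfolding pd_def by (rule DERIV_imp_deriv[OF *])
qed

lemma holo_on_has_derivative:
  fixes f :: "complex^'n \<Rightarrow> complex"
  assumes "f holo_on U" "z \<in> U"
  shows "(f has_derivative (\<lambda>v. \<Sum>k\<in>UNIV. v $ k * pd k f z)) (at z)"
proof -
  obtain f' where f': "(f has_derivative f') (at z)" and lin: "\<And>c v. f' (c *s v) = c * f' v"
    using assms unfolding holo_on_def by blast
  interpret bounded_linear f' using f' by (rule has_derivative_bounded_linear)
  have "f' v = (\<Sum>k\<in>UNIV. v $ k * pd k f z)" for v
  proof -
    have "f' v = f' (\<Sum>k\<in>UNIV. v $ k *s axis k 1)" by (simp only: basis_expansion)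
    then show ?thesis by (simp add: sum lin pd_eqI(2)[OF f' lin])
  qed
  then have "f' = (\<lambda>v. \<Sum>k\<in>UNIV. v $ k * pd k f z)" by blast
  with f' show ?thesis by simp
qed

text \<open>Exhibiting the derivative as a sum over coordinates proves holomorphy and reads off all
  partial derivatives at once, so the calculus rules below can be proved in such pairs.\<close>

lemma has_derivative_holo_on:
  fixes f :: "complex^'n \<Rightarrow> complex"
  assumes "\<And>z. z \<in> U \<Longrightarrow> (f has_derivative (\<lambda>v. \<Sum>k\<in>UNIV. v $ k * D k z)) (at z)"
  shows "f holo_on U" and "\<And>z k. z \<in> U \<Longrightarrow> pd k f z = D k z"
proof -
  have lin: "(\<Sum>k\<in>UNIV. (c *s v) $ k * D k z) = c * (\<Sum>k\<in>UNIV. v $ k * D k z)" for c v z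
    by (simp add: sum_distrib_left mult.assoc)
  show "f holo_on U" unfolding holo_on_def using assms lin by blast
  show "pd k f z = D k z" if "z \<in> U" for z k
  proof -
    have "pd k f z = (\<Sum>j\<in>UNIV. axis k 1 $ j * D j z)"
      by (rule pd_eqI(2)[OF assms[OF that] lin])
    also have "\<dots> = (\<Sum>j\<in>UNIV. if j = k then D j z else 0)"
      by (intro sum.cong) (auto simp: axis_def)
    finally show ?thesis by simp
  qed
qed

lemma holo_on_subset: "f holo_on U \<Longrightarrow> V \<subseteq> U \<Longrightarrow> f holo_on V"
  unfolding holo_on_def by blast

text \<open>The derivative in \<open>holo_on\<close> is taken \<open>at z\<close>, not within the
  set, so \<open>f holo_on {z}\<close> means complex differentiability at \<open>z\<close>. In this
  form it is the side condition of the \<open>pd\<close> rules.\<close>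

lemma holo_on_at: "f holo_on U \<Longrightarrow> z \<in> U \<Longrightarrow> f holo_on {z}"
  unfolding holo_on_def by blast

lemma holo_onI_at: "(\<And>z. z \<in> U \<Longrightarrow> f holo_on {z}) \<Longrightarrow> f holo_on U"
  unfolding holo_on_def by blast

lemma holo_on_continuous_on: "f holo_on U \<Longrightarrow> continuous_on U f"
  by (meson continuous_at_imp_continuous_on has_derivative_continuous holo_on_has_derivative)

lemma
  fixes f :: "complex^'n \<Rightarrow> complex" and m :: "complex^'m \<Rightarrow> complex^'n"
  assumes f: "f holo_on V" and m: "\<And>j. (\<lambda>z. m z $ j) holo_on U" and mem: "\<And>z. z \<in> U \<Longrightarrow> m z \<in> V"
  shows holo_on_compose: "(\<lambda>z. f (m z)) holo_on U"
    and pd_compose: "\<And>z k. z \<in> U \<Longrightarrow>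
      pd k (\<lambda>z. f (m z)) z = (\<Sum>j\<in>UNIV. pd j f (m z) * pd k (\<lambda>z. m z $ j) z)"
proof -
  have *: "((\<lambda>z. f (m z)) has_derivative
      (\<lambda>v. \<Sum>k\<in>UNIV. v $ k * (\<Sum>j\<in>UNIV. pd j f (m z) * pd k (\<lambda>z. m z $ j) z))) (at z)"
    if z: "z \<in> U" for z
  proof -
    have "(m has_derivative (\<lambda>v. \<chi> j. \<Sum>k\<in>UNIV. v $ k * pd k (\<lambda>z. m z $ j) z)) (at z)"
      unfolding has_derivative_componentwise_within[where f=m]
    proof
      fix b :: "complex^'n" assume "b \<in> Basis"
      then obtain j c where b: "b = axis j c" "c \<in> Basis" unfolding Basis_vec_def by blast
      have "((\<lambda>z. m z $ j \<bullet> c) has_derivative (\<lambda>v. (\<Sum>k\<in>UNIV. v $ k * pd k (\<lambda>z. m z $ j) z) \<bullet> c)) (at z)"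
        using holo_on_has_derivative[OF m z] by (intro derivative_intros)
      then show "((\<lambda>x. m x \<bullet> b) has_derivative
           (\<lambda>x. (\<chi> j. \<Sum>k\<in>UNIV. x $ k * pd k (\<lambda>z. m z $ j) z) \<bullet> b)) (at z)"
        by (simp add: b inner_axis)
    qed
    from has_derivative_compose[OF this holo_on_has_derivative[OF f mem[OF z]]]
    show ?thesis
    proof (rule has_derivative_eq_rhs)
      show "(\<lambda>v. \<Sum>j\<in>UNIV. (\<chi> j. \<Sum>k\<in>UNIV. v $ k * pd k (\<lambda>z. m z $ j) z) $ j * pd j f (m z)) =
         (\<lambda>v. \<Sum>k\<in>UNIV. v $ k * (\<Sum>j\<in>UNIV. pd j f (m z) * pd k (\<lambda>z. m z $ j) z))"
        apply (rule ext)
        apply (simp add: sum_distrib_left sum_distrib_right)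
        apply (subst sum.swap)
        apply (simp add: mult_ac)
        done
    qed
  qed
  show "(\<lambda>z. f (m z)) holo_on U" using * by (rule has_derivative_holo_on(1))
  show "pd k (\<lambda>z. f (m z)) z = (\<Sum>j\<in>UNIV. pd j f (m z) * pd k (\<lambda>z. m z $ j) z)" if "z \<in> U" for z k
    using * that by (rule has_derivative_holo_on(2))
qed

lemma
  fixes f :: "complex^'n \<Rightarrow> complex"
  assumes f: "f holo_on U" and \<phi>: "\<And>z. z \<in> U \<Longrightarrow> (\<phi> has_field_derivative \<phi>' (f z)) (at (f z))"
  shows holo_on_compose_field: "(\<lambda>z. \<phi> (f z)) holo_on U"
    and pd_compose_field: "\<And>z k. z \<in> U \<Longrightarrow> pd k (\<lambda>z. \<phi> (f z)) z = \<phi>' (f z) * pd k f z"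
proof -
  have *: "((\<lambda>z. \<phi> (f z)) has_derivative (\<lambda>v. \<Sum>k\<in>UNIV. v $ k * (\<phi>' (f z) * pd k f z))) (at z)"
    if z: "z \<in> U" for z
    using has_derivative_compose[OF holo_on_has_derivative[OF f z] \<phi>[OF z, unfolded has_field_derivative_def]]
    by (simp add: sum_distrib_left mult.left_commute)
  show "(\<lambda>z. \<phi> (f z)) holo_on U" using * by (rule has_derivative_holo_on(1))
  show "pd k (\<lambda>z. \<phi> (f z)) z = \<phi>' (f z) * pd k f z" if "z \<in> U" for z k
    using * that by (rule has_derivative_holo_on(2))
qed

lemma
  fixes f g :: "complex^'n \<Rightarrow> complex"
  assumes f: "f holo_on U" and g: "g holo_on U"
  shows holo_on_add: "(\<lambda>z. f z + g z) holo_on U"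
    and pd_add_on: "\<And>z k. z \<in> U \<Longrightarrow> pd k (\<lambda>z. f z + g z) z = pd k f z + pd k g z"
    and holo_on_mult: "(\<lambda>z. f z * g z) holo_on U"
    and pd_mult_on: "\<And>z k. z \<in> U \<Longrightarrow> pd k (\<lambda>z. f z * g z) z = pd k f z * g z + f z * pd k g z"
proof -
  note D = holo_on_has_derivative[OF f] holo_on_has_derivative[OF g]
  have add: "((\<lambda>z. f z + g z) has_derivative (\<lambda>v. \<Sum>k\<in>UNIV. v $ k * (pd k f z + pd k g z))) (at z)"
    if "z \<in> U" for z
    using has_derivative_add[OF D(1) D(2), OF that that] by (simp add: sum.distrib algebra_simps)
  show "(\<lambda>z. f z + g z) holo_on U" by (rule has_derivative_holo_on(1)) (rule add)
  show "pd k (\<lambda>z. f z + g z) z = pd k f z + pd k g z" if "z \<in> U" for z k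
    using add that by (rule has_derivative_holo_on(2))
  have mult: "((\<lambda>z. f z * g z) has_derivative
      (\<lambda>v. \<Sum>k\<in>UNIV. v $ k * (pd k f z * g z + f z * pd k g z))) (at z)" if "z \<in> U" for z
    using has_derivative_mult[OF D(1) D(2), OF that that]
    by (simp add: sum.distrib sum_distrib_left algebra_simps)
  show "(\<lambda>z. f z * g z) holo_on U" by (rule has_derivative_holo_on(1)) (rule mult)
  show "pd k (\<lambda>z. f z * g z) z = pd k f z * g z + f z * pd k g z" if "z \<in> U" for z k
    using mult that by (rule has_derivative_holo_on(2))
qed

lemma
  fixes U :: "(complex^'n) set"
  shows holo_on_const: "(\<lambda>_. c) holo_on U"
    and pd_const: "pd k (\<lambda>_. c) (z :: complex^'n) = 0"
    and holo_on_coord: "(\<lambda>z. z $ j) holo_on U"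
    and pd_coord: "pd k (\<lambda>z. z $ j) (z :: complex^'n) = (if j = k then 1 else 0)"
proof -
  have c: "((\<lambda>_. c) has_derivative (\<lambda>v. \<Sum>k\<in>UNIV. v $ k * 0)) (at z)" for z :: "complex^'n"
    by simp
  show "(\<lambda>_. c) holo_on U" using c by (rule has_derivative_holo_on(1))
  show "pd k (\<lambda>_. c) (z :: complex^'n) = 0" using c UNIV_I by (rule has_derivative_holo_on(2))
  have j: "((\<lambda>z. z $ j) has_derivative (\<lambda>v. \<Sum>k\<in>UNIV. v $ k * (if j = k then 1 else 0))) (at z)"
    for z :: "complex^'n"
  proof -
    have "(\<Sum>k\<in>UNIV. v $ k * (if j = k then 1 else 0)) = v $ j" for v :: "complex^'n"
      by (simp add: if_distrib cong: if_cong)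
    then show ?thesis
      by (simp add: bounded_linear_vec_nth bounded_linear_imp_has_derivative)
  qed
  show "(\<lambda>z. z $ j) holo_on U" using j by (rule has_derivative_holo_on(1))
  show "pd k (\<lambda>z. z $ j) (z :: complex^'n) = (if j = k then 1 else 0)"
    using j UNIV_I by (rule has_derivative_holo_on(2))
qed

lemma holo_on_minus: "f holo_on U \<Longrightarrow> (\<lambda>z. - f z) holo_on U"
  using holo_on_mult[OF holo_on_const[of "-1"]] by fastforce

lemma holo_on_diff: "f holo_on U \<Longrightarrow> g holo_on U \<Longrightarrow> (\<lambda>z. f z - g z) holo_on U"
  using holo_on_add[OF _ holo_on_minus] by fastforce

lemma holo_on_power: "f holo_on U \<Longrightarrow> (\<lambda>z. f z ^ n) holo_on U"
  by (induction n) (auto intro: holo_on_const holo_on_mult)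

lemma holo_on_inverse: "f holo_on U \<Longrightarrow> (\<And>z. z \<in> U \<Longrightarrow> f z \<noteq> 0) \<Longrightarrow> (\<lambda>z. inverse (f z)) holo_on U"
  by (rule holo_on_compose_field) (auto intro: DERIV_inverse)

lemma holo_on_divide:
  "f holo_on U \<Longrightarrow> g holo_on U \<Longrightarrow> (\<And>z. z \<in> U \<Longrightarrow> g z \<noteq> 0) \<Longrightarrow> (\<lambda>z. f z / g z) holo_on U"
  unfolding divide_inverse by (intro holo_on_mult holo_on_inverse)

lemmas holo_intros = holo_on_const holo_on_coord holo_on_add holo_on_mult holo_on_minus
  holo_on_diff holo_on_power holo_on_divide

lemma pd_add: "f holo_on {z} \<Longrightarrow> g holo_on {z} \<Longrightarrow> pd k (\<lambda>z. f z + g z) z = pd k f z + pd k g z"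
  by (rule pd_add_on) auto

lemma pd_mult: "f holo_on {z} \<Longrightarrow> g holo_on {z} \<Longrightarrow>
    pd k (\<lambda>z. f z * g z) z = pd k f z * g z + f z * pd k g z"
  by (rule pd_mult_on) auto

lemma pd_minus: "f holo_on {z} \<Longrightarrow> pd k (\<lambda>z. - f z) z = - pd k f z"
  using pd_mult[OF holo_on_const[of "-1"], of f z k] by (simp add: pd_const)

lemma pd_diff: "f holo_on {z} \<Longrightarrow> g holo_on {z} \<Longrightarrow> pd k (\<lambda>z. f z - g z) z = pd k f z - pd k g z"
  using pd_add[OF _ holo_on_minus, of f z g k] by (simp add: pd_minus)

lemma pd_power: "f holo_on {z} \<Longrightarrow> pd k (\<lambda>z. f z ^ n) z = of_nat n * f z ^ (n - 1) * pd k f z"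
  by (rule pd_compose_field[where \<phi>' = "\<lambda>w. of_nat n * w ^ (n - 1)"])
     (auto intro!: derivative_eq_intros)

lemma pd_divide: "f holo_on {z} \<Longrightarrow> g holo_on {z} \<Longrightarrow> g z \<noteq> 0 \<Longrightarrow>
    pd k (\<lambda>z. f z / g z) z = (pd k f z * g z - f z * pd k g z) / (g z)\<^sup>2"
proof -
  assume *: "f holo_on {z}" "g holo_on {z}" "g z \<noteq> 0"
  have "pd k (\<lambda>z. inverse (g z)) z = - (inverse (g z) * inverse (g z)) * pd k g z"
    by (rule pd_compose_field[where \<phi>' = "\<lambda>w. - (inverse w * inverse w)", OF *(2)])
       (use * DERIV_inverse in \<open>auto simp: power2_eq_square\<close>)
  then show ?thesis
    using * pd_mult[OF *(1) holo_on_inverse[OF *(2)], of k]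
    by (simp add: field_simps power2_eq_square)
qed

lemmas pd_simps = pd_const pd_coord pd_add pd_mult pd_minus pd_diff pd_power pd_divide

lemma
  assumes "open U" "z \<in> U" "\<And>w. w \<in> U \<Longrightarrow> f w = g w"
  shows pd_cong_open: "pd k f z = pd k g z"
    and holo_on_cong_at: "f holo_on {z} \<longleftrightarrow> g holo_on {z}"
proof -
  have "((\<lambda>t. z + t *s axis k 1) \<longlongrightarrow> z + 0 *s axis k 1) (at (0::complex))"
    by (intro tendsto_intros bounded_linear.tendsto[OF smult_axis_bounded_linear])
  then have "((\<lambda>t. z + t *s axis k 1) \<longlongrightarrow> z) (nhds (0::complex))"
    by (simp add: tendsto_nhds_iff)
  then have "\<forall>\<^sub>F t in nhds (0::complex). z + t *s axis k 1 \<in> U"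
    using assms(1,2) by (rule topological_tendstoD)
  then have "\<forall>\<^sub>F t in nhds (0::complex). f (z + t *s axis k 1) = g (z + t *s axis k 1)"
    by eventually_elim (rule assms(3))
  then show "pd k f z = pd k g z" unfolding pd_def by (rule deriv_cong_ev) simp
  have "(f has_derivative f') (at z) \<longleftrightarrow> (g has_derivative f') (at z)" for f'
    using assms has_derivative_transform_within_open by metis
  then show "f holo_on {z} \<longleftrightarrow> g holo_on {z}" unfolding holo_on_def by simp
qed

lemma holo_on_cong:
  assumes "open U" "\<And>w. w \<in> U \<Longrightarrow> f w = g w"
  shows "f holo_on U \<longleftrightarrow> g holo_on U"
  using assms holo_on_cong_at by (metis holo_onI_at holo_on_at)

section \<open>Integral formulas and higher derivatives\<close>

lemma smult_axis: "t *s axis k 1 = (axis k t :: complex^'n)"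
  by (simp add: vec_eq_iff axis_def)

text \<open>Differentiation under the integral sign, applied later to Cauchy integrals over circles
  and to primitives along segments.\<close>

lemma
  fixes \<phi> :: "complex^'n \<Rightarrow> real \<Rightarrow> complex"
  assumes U: "open U"
    and holo: "\<And>t. t \<in> {a..b} \<Longrightarrow> (\<lambda>z. \<phi> z t) holo_on U"
    and int: "\<And>z. z \<in> U \<Longrightarrow> \<phi> z integrable_on {a..b}"
    and cont: "\<And>k. continuous_on (U \<times> {a..b}) (\<lambda>(z, t). pd k (\<lambda>z. \<phi> z t) z)"
  shows holo_on_integral: "(\<lambda>z. integral {a..b} (\<phi> z)) holo_on U"
    and pd_integral: "\<And>z k. z \<in> U \<Longrightarrow>
      pd k (\<lambda>z. integral {a..b} (\<phi> z)) z = integral {a..b} (\<lambda>t. pd k (\<lambda>z. \<phi> z t) z)"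
proof -
  \<comment> \<open>\<open>leibniz_rule\<close> asks for the derivative as a continuous family of
    bounded operators. In finite dimension this reduces to continuity of the partial
    derivatives.\<close>
  define D where "D z t = Blinfun (\<lambda>v. \<Sum>k\<in>UNIV. v $ k * pd k (\<lambda>z. \<phi> z t) z)" for z t
  have D: "blinfun_apply (D z t) = (\<lambda>v. \<Sum>k\<in>UNIV. v $ k * pd k (\<lambda>z. \<phi> z t) z)" for z t
    unfolding D_def
    by (rule bounded_linear_Blinfun_apply)
       (intro bounded_linear_sum bounded_linear_mult_const bounded_linear_vec_nth)
  have "((\<lambda>z. integral {a..b} (\<phi> z)) has_derivative
      (\<lambda>v. \<Sum>k\<in>UNIV. v $ k * integral {a..b} (\<lambda>t. pd k (\<lambda>z. \<phi> z t) z))) (at z)"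
    if z: "z \<in> U" for z
  proof -
    obtain e where e: "e > 0" "ball z e \<subseteq> U" using U z openE by blast
    have c: "continuous_on (ball z e \<times> {a..b}) (\<lambda>(z, t). pd k (\<lambda>z. \<phi> z t) z)" for k
      by (rule continuous_on_subset[OF cont]) (use e in auto)
    have cD: "continuous_on (ball z e \<times> {a..b}) (\<lambda>(z, t). D z t)"
      by (rule continuous_on_blinfun_componentwise)
         (use c in \<open>auto simp: D split_beta intro!: continuous_intros\<close>)
    have "((\<lambda>z. integral (cbox a b) (\<phi> z)) has_derivative blinfun_apply (integral (cbox a b) (D z)))
        (at z within ball z e)"
    proof (rule leibniz_rule)
      show "((\<lambda>x. \<phi> x t) has_derivative blinfun_apply (D x t)) (at x within ball z e)"
        if "x \<in> ball z e" "t \<in> cbox a b" for x t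
        unfolding D using that e holo
        by (intro has_derivative_at_withinI[OF holo_on_has_derivative[of _ U]]) auto
    qed (use e int cD in auto)
    moreover have "blinfun_apply (integral (cbox a b) (D z)) =
        (\<lambda>v. \<Sum>k\<in>UNIV. v $ k * integral {a..b} (\<lambda>t. pd k (\<lambda>z. \<phi> z t) z))"
    proof
      fix v
      have P: "continuous_on {a..b} (Pair z)" "Pair z ` {a..b} \<subseteq> ball z e \<times> {a..b}"
        using e by (auto intro: continuous_on_Pair[OF continuous_on_const continuous_on_id])
      have cz: "continuous_on {a..b} (\<lambda>t. pd k (\<lambda>z. \<phi> z t) z)" for k
        using continuous_on_compose2[OF c P] by simp
      have "continuous_on {a..b} (D z)"
        using continuous_on_compose2[OF cD P] by simp
      then have "D z integrable_on cbox a b" by (simp add: integrable_continuous_real)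
      then have "blinfun_apply (integral (cbox a b) (D z)) v = integral (cbox a b) (\<lambda>t. D z t v)"
        by (simp add: blinfun_apply_integral)
      also have "\<dots> = (\<Sum>k\<in>UNIV. v $ k * integral {a..b} (\<lambda>t. pd k (\<lambda>z. \<phi> z t) z))"
        unfolding D using cz
        by (subst integral_sum) (auto intro!: integrable_continuous_real continuous_intros)
      finally show "blinfun_apply (integral (cbox a b) (D z)) v = \<dots>" .
    qed
    ultimately have "((\<lambda>z. integral {a..b} (\<phi> z)) has_derivative
        (\<lambda>v. \<Sum>k\<in>UNIV. v $ k * integral {a..b} (\<lambda>t. pd k (\<lambda>z. \<phi> z t) z))) (at z within ball z e)"
      by simp
    then show ?thesis using e at_within_open[of z "ball z e"] by simp
  qed
  from has_derivative_holo_on[OF this]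
  show "(\<lambda>z. integral {a..b} (\<phi> z)) holo_on U"
    and "\<And>z k. z \<in> U \<Longrightarrow>
      pd k (\<lambda>z. integral {a..b} (\<phi> z)) z = integral {a..b} (\<lambda>t. pd k (\<lambda>z. \<phi> z t) z)"
    by blast+
qed

lemma norm_axis: "norm (axis k (t::complex) :: complex^'n) = norm t"
proof -
  have "(\<Sum>i\<in>UNIV. (norm ((axis k t :: complex^'n) $ i))\<^sup>2) = (\<Sum>i\<in>UNIV. if i = k then (norm t)\<^sup>2 else 0)"
    by (intro sum.cong) (auto simp: axis_def)
  then show ?thesis by (simp add: norm_vec_def L2_set_def)
qed

lemma circlepath_ne_0: "r > 0 \<Longrightarrow> circlepath 0 r t \<noteq> 0"
  by (simp add: circlepath)

lemma add_axis_in_cball: "norm (t::complex) \<le> r \<Longrightarrow> z + axis k t \<in> cball z r"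
  by (simp add: dist_norm norm_axis)

text \<open>Cauchy's formula for the first derivative, on a circle in the \<open>k\<close>-th
  complex coordinate line through \<open>z\<close>.\<close>

lemma pd_eq_integral:
  fixes f :: "complex^'n \<Rightarrow> complex"
  assumes "open U" "f holo_on U" "r > 0" "cball z r \<subseteq> U"
  shows "pd k f z = integral {0..1} (\<lambda>t. f (z + axis k (circlepath 0 r t)) / circlepath 0 r t)"
proof -
  define h where "h t = f (z + t *s axis k 1)" for t
  have D: "\<exists>D. (h has_field_derivative D) (at t)" if t: "norm t \<le> r" for t
  proof -
    have mem: "z + t *s axis k 1 \<in> U"
      unfolding smult_axis using add_axis_in_cball[OF t] assms(4) by blast
    then obtain f' where f': "(f has_derivative f') (at (z + t *s axis k 1))" "\<And>c v. f' (c *s v) = c * f' v"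
      using assms(2) unfolding holo_on_def by blast
    have "((\<lambda>s. f ((z + t *s axis k 1) + s *s axis k 1)) has_field_derivative f' (axis k 1)) (at 0)"
      by (rule pd_eqI(1)[OF f'])
    moreover have "f ((z + t *s axis k 1) + s *s axis k 1) = h (s + t)" for s
      unfolding h_def by (rule arg_cong[of _ _ f]) (simp add: vec_eq_iff algebra_simps)
    ultimately have "((\<lambda>s. h (s + t)) has_field_derivative f' (axis k 1)) (at 0)" by simp
    then show ?thesis unfolding DERIV_shift[symmetric] by auto
  qed
  then have holh: "h holomorphic_on cball 0 r"
    unfolding holomorphic_on_def field_differentiable_def
    using has_field_derivative_at_within mem_cball_0 by blast
  have "contour_integral (circlepath 0 r) (\<lambda>u. h u / (u - 0)^2) = (2 * pi * \<i>) * deriv h 0"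
    using assms(3) holh
    by (intro Cauchy_contour_integral_circlepath_2 holomorphic_on_imp_continuous_on)
       (auto intro: holomorphic_on_subset)
  then have "(2 * pi * \<i>) * pd k f z = contour_integral (circlepath 0 r) (\<lambda>u. h u / u^2)"
    unfolding pd_def h_def by simp
  \<comment> \<open>On the circle \<open>du = 2 pi \<i> u dt\<close>, which cancels one factor of
    the denominator \<open>u^2\<close>.\<close>
  also have "\<dots> = integral {0..1} (\<lambda>t. (2 * pi * \<i>) * (h (circlepath 0 r t) / circlepath 0 r t))"
    unfolding contour_integral_integral vector_derivative_circlepath
    using circlepath_ne_0[OF assms(3)]
    by (intro integral_cong)
       (simp add: field_simps power2_eq_square circlepath)
  also have "\<dots> = (2 * pi * \<i>) * integral {0..1} (\<lambda>t. h (circlepath 0 r t) / circlepath 0 r t)"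
    by (rule integral_mult_right)
  finally show ?thesis by (simp add: h_def smult_axis)
qed

lemma continuous_on_circle:
  fixes f :: "complex^'n \<Rightarrow> complex"
  assumes f: "continuous_on U f" and r: "r > 0"
    and mem: "\<And>w t. w \<in> B \<Longrightarrow> w + axis k (circlepath 0 r t) \<in> U"
  shows "continuous_on (B \<times> T) (\<lambda>(w, t). f (w + axis k (circlepath 0 r t)) / circlepath 0 r t)"
proof -
  have "continuous_on (B \<times> T) (\<lambda>p. circlepath 0 r (snd p))"
    unfolding circlepath by (intro continuous_intros)
  moreover from bounded_linear.continuous_on[OF smult_axis_bounded_linear this]
  have "continuous_on (B \<times> T) (\<lambda>p. axis k (circlepath 0 r (snd p)) :: complex^'n)"
    unfolding smult_axis .
  then have "continuous_on (B \<times> T) (\<lambda>p. fst p + axis k (circlepath 0 r (snd p)))"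
    by (intro continuous_intros)
  from continuous_on_compose2[OF f this]
  have "continuous_on (B \<times> T) (\<lambda>p. f (fst p + axis k (circlepath 0 r (snd p))))"
    using mem by (simp add: image_subset_iff mem_Times_iff)
  ultimately show ?thesis
    unfolding split_beta using circlepath_ne_0[OF r] by (intro continuous_on_divide) auto
qed

lemma
  fixes f :: "complex^'n \<Rightarrow> complex"
  shows pd_translate: "pd k (\<lambda>z. f (z + c)) z = pd k f (z + c)"
    and holo_on_translate: "f holo_on {z + c} \<Longrightarrow> (\<lambda>z. f (z + c)) holo_on {z}"
proof -
  show "pd k (\<lambda>z. f (z + c)) z = pd k f (z + c)"
    unfolding pd_def by (simp only: add.assoc add.commute[of _ c])
  assume f: "f holo_on {z + c}"
  show "(\<lambda>z. f (z + c)) holo_on {z}"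
    by (rule holo_on_compose[OF f]) (simp_all only: vector_add_component holo_on_add holo_on_coord holo_on_const singleton_iff)
qed

text \<open>A single radius serves all centres near \<open>z\<close>, so that the Cauchy integral
  can be varied with its centre.\<close>

lemma uniform_cball_subset:
  fixes z :: "complex^'n"
  assumes "open U" "z \<in> U"
  obtains r B where "r > 0" "open B" "z \<in> B" "B \<subseteq> U" "\<forall>w\<in>B. cball w r \<subseteq> U"
    "\<forall>w\<in>B. \<forall>t k. w + axis k (circlepath 0 r t) \<in> U"
proof -
  obtain r where r: "r > 0" "ball z r \<subseteq> U" using assms openE by blast
  have sub: "cball w (r/3) \<subseteq> U" if "w \<in> ball z (r/3)" for w
  proof -
    have "cball w (r/3) \<subseteq> ball z r"
    proof
      fix x assume "x \<in> cball w (r/3)"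
      then have "dist w x \<le> r/3" "dist z w < r/3" using that by simp_all
      then show "x \<in> ball z r" using dist_triangle[of z x w] r by simp
    qed
    then show ?thesis using r by blast
  qed
  show thesis
  proof (rule that[of "r/3" "ball z (r/3)"])
    have "w + axis k (circlepath 0 (r/3) t) \<in> cball w (r/3)" for w t k
      using r by (intro add_axis_in_cball) (simp add: circlepath norm_mult)
    then show "\<forall>w\<in>ball z (r/3). \<forall>t k. w + axis k (circlepath 0 (r/3) t) \<in> U" using sub by blast
  next
    show "ball z (r/3) \<subseteq> U" using r subset_ball[of "r/3" r z] by (simp add: subset_trans)
  qed (use r sub in auto)
qed

text \<open>Holomorphy is only assumed as pointwise differentiability, so continuity of the partial
  derivatives comes first, from the Cauchy integral of the continuous \<open>f\<close>. It permits
  differentiating that integral in its centre, which shows that \<open>pd k f\<close> is holomorphic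
  and that \<open>pd j (pd k f)\<close> is the Cauchy integral of \<open>pd j f\<close>, hence equal
  to \<open>pd k (pd j f)\<close>.\<close>

lemma
  fixes f :: "complex^'n \<Rightarrow> complex"
  assumes U: "open U" and f: "f holo_on U"
  shows continuous_on_pd: "continuous_on U (pd k f)"
    and holo_on_pd: "pd k f holo_on U"
    and pd_commute: "\<And>z. z \<in> U \<Longrightarrow> pd j (pd k f) z = pd k (pd j f) z"
proof -
  have cont: "continuous_on U (pd k f)" for k
  proof (rule continuous_at_imp_continuous_on, rule ballI)
    fix z assume zU: "z \<in> U"
    obtain r B where r: "r > 0" and B: "open B" "z \<in> B" "B \<subseteq> U" "\<forall>w\<in>B. cball w r \<subseteq> U"
      "\<forall>w\<in>B. \<forall>t k. w + axis k (circlepath 0 r t) \<in> U" by (rule uniform_cball_subset[OF U zU])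
    have "continuous_on (B \<times> {0..1}) (\<lambda>(w, t). f (w + axis k (circlepath 0 r t)) / circlepath 0 r t)"
      by (rule continuous_on_circle[OF holo_on_continuous_on[OF f] r]) (use B(5) in blast)
    then have "continuous_on B (\<lambda>w. integral (cbox 0 1) (\<lambda>t. f (w + axis k (circlepath 0 r t)) / circlepath 0 r t))"
      by (intro integral_continuous_on_param) (simp only: cbox_interval)
    then have "continuous_on B (pd k f)"
      using pd_eq_integral[OF U f r] B(4) by simp
    then show "isCont (pd k f) z" using B(1,2) by (simp add: continuous_on_eq_continuous_at)
  qed
  then show "continuous_on U (pd k f)" .
  \<comment> \<open>The radius is part of the claim so that both orders of differentiation can be
    compared on the same circle.\<close>
  have main: "pd k f holo_on {z} \<and> (\<exists>r>0. cball z r \<subseteq> U \<and> (\<forall>j. pd j (pd k f) z =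
      integral {0..1} (\<lambda>t. pd j f (z + axis k (circlepath 0 r t)) / circlepath 0 r t)))"
    if zU: "z \<in> U" for z k
  proof -
    obtain r B where r: "r > 0" and B: "open B" "z \<in> B" "B \<subseteq> U" "\<forall>w\<in>B. cball w r \<subseteq> U"
      "\<forall>w\<in>B. \<forall>t k. w + axis k (circlepath 0 r t) \<in> U" by (rule uniform_cball_subset[OF U zU])
    define \<phi> where "\<phi> w t = f (w + axis k (circlepath 0 r t)) / circlepath 0 r t" for w t
    have holo: "(\<lambda>w. f (w + axis k (circlepath 0 r t))) holo_on {w}" if "w \<in> B" for w t
      by (rule holo_on_translate) (rule holo_on_at[OF f B(5)[rule_format, OF that]])
    have holo\<phi>: "(\<lambda>w. \<phi> w t) holo_on B" for t
      unfolding \<phi>_def using circlepath_ne_0[OF r] holo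
      by - (rule holo_onI_at, rule holo_on_divide, auto intro: holo_on_const)
    have pd\<phi>: "pd j (\<lambda>w. \<phi> w t) w = pd j f (w + axis k (circlepath 0 r t)) / circlepath 0 r t"
      if "w \<in> B" for w t j
    proof -
      have "pd j (\<lambda>w. f (w + axis k (circlepath 0 r t)) * inverse (circlepath 0 r t)) w =
          pd j f (w + axis k (circlepath 0 r t)) * inverse (circlepath 0 r t)"
        by (simp add: pd_mult[OF holo[OF that] holo_on_const] pd_const pd_translate)
      then show ?thesis by (simp add: \<phi>_def divide_inverse)
    qed
    have "continuous_on (B \<times> {0..1}) (\<lambda>(w, t). \<phi> w t)"
      unfolding \<phi>_def by (rule continuous_on_circle[OF holo_on_continuous_on[OF f] r]) (use B(5) in blast)
    from continuous_on_compose2[OF this continuous_on_Pair[OF continuous_on_const continuous_on_id]]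
    have int: "\<phi> w integrable_on {0..1}" if "w \<in> B" for w
      using that by (intro integrable_continuous_real) auto
    have "continuous_on (B \<times> {0..1})
        (\<lambda>(w, t). pd j f (w + axis k (circlepath 0 r t)) / circlepath 0 r t)" for j
      by (rule continuous_on_circle[OF cont r]) (use B(5) in blast)
    then have cont\<phi>: "continuous_on (B \<times> {0..1}) (\<lambda>(w, t). pd j (\<lambda>w. \<phi> w t) w)" for j
      by (rule continuous_on_eq) (auto simp: pd\<phi>)
    have eq: "pd k f w = integral {0..1} (\<phi> w)" if "w \<in> B" for w
      using pd_eq_integral[OF U f r] B(4) that by (simp add: \<phi>_def[abs_def])
    have "(\<lambda>w. integral {0..1} (\<phi> w)) holo_on B"
      by (rule holo_on_integral[OF B(1) holo\<phi> int cont\<phi>])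
    then have "pd k f holo_on B" using holo_on_cong[OF B(1) eq] by simp
    then have "pd k f holo_on {z}" using B(2) by (rule holo_on_at)
    moreover have "pd j (pd k f) z =
        integral {0..1} (\<lambda>t. pd j f (z + axis k (circlepath 0 r t)) / circlepath 0 r t)" for j
      using pd_integral[OF B(1) holo\<phi> int cont\<phi> B(2), where k=j] pd_cong_open[OF B(1,2) eq, where k=j]
      by (simp add: pd\<phi>[OF B(2)])
    moreover have "cball z r \<subseteq> U" using B(2,4) by blast
    ultimately show ?thesis using r by (intro conjI exI[of _ r]) simp_all
  qed
  have holo: "pd k f holo_on U" for k by (rule holo_onI_at) (simp add: main)
  then show "pd k f holo_on U" .
  fix z assume z: "z \<in> U"
  from main[OF z, of k] obtain r where r: "r > 0" "cball z r \<subseteq> U" "\<And>j. pd j (pd k f) z =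
      integral {0..1} (\<lambda>t. pd j f (z + axis k (circlepath 0 r t)) / circlepath 0 r t)" by auto
  then show "pd j (pd k f) z = pd k (pd j f) z"
    using pd_eq_integral[OF U holo r(1,2)] by simp
qed

section \<open>Primitives in one coordinate direction\<close>

definition contract :: "complex^'n \<Rightarrow> 'n \<Rightarrow> real \<Rightarrow> complex^'n \<Rightarrow> complex^'n" where
  "contract a k t z = (\<chi> i. if i = k then a $ k + of_real t * (z $ k - a $ k) else z $ i)"

text \<open>No coordinate gets farther from that of \<open>a\<close>, so the segments used for
  integration stay in the ball.\<close>

lemma contract_in_ball:
  assumes "z \<in> ball a r" "t \<in> {0..1}"
  shows "contract a k t z \<in> ball a r"
proof -
  have "norm ((contract a k t z - a) $ i) \<le> norm ((z - a) $ i)" for i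
    using assms(2) by (auto simp: contract_def norm_mult mult_left_le_one_le)
  then have "norm (contract a k t z - a) \<le> norm (z - a)"
    unfolding norm_vec_def by (intro L2_set_mono) auto
  then show ?thesis using assms(1) by (simp add: dist_norm norm_minus_commute)
qed

lemma holo_on_contract_nth: "(\<lambda>z. contract a k t z $ i) holo_on S"
  unfolding contract_def by (cases "i = k") (auto intro!: holo_intros)

lemma pd_contract_nth:
  "pd j (\<lambda>z. contract a k t z $ i) z = (if i = j then if j = k then of_real t else 1 else 0)"
  unfolding contract_def by (cases "i = k") (auto simp: pd_simps holo_intros)

lemma
  fixes f :: "complex^'n \<Rightarrow> complex"
  assumes f: "f holo_on ball a r" and t: "t \<in> {0..1}"
  shows holo_on_comp_contract: "(\<lambda>z. f (contract a k t z)) holo_on ball a r"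
    and pd_comp_contract: "z \<in> ball a r \<Longrightarrow> pd j (\<lambda>z. f (contract a k t z)) z =
      pd j f (contract a k t z) * (if j = k then of_real t else 1)"
proof -
  show "(\<lambda>z. f (contract a k t z)) holo_on ball a r"
    by (rule holo_on_compose[OF f holo_on_contract_nth contract_in_ball[OF _ t]])
  assume z: "z \<in> ball a r"
  have "pd j (\<lambda>z. f (contract a k t z)) z =
      (\<Sum>i\<in>UNIV. pd i f (contract a k t z) * (if i = j then if j = k then of_real t else 1 else 0))"
    using pd_compose[OF f holo_on_contract_nth contract_in_ball[OF _ t] z]
    by (simp only: pd_contract_nth)
  also have "\<dots> = (\<Sum>i\<in>UNIV. if i = j then pd j f (contract a k t z) * (if j = k then of_real t else 1) else 0)"
    by (intro sum.cong) auto
  finally show "pd j (\<lambda>z. f (contract a k t z)) z =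
      pd j f (contract a k t z) * (if j = k then of_real t else 1)" by simp
qed

lemma continuous_on_contract: "continuous_on S (\<lambda>p. contract a k (snd p) (fst p))"
  unfolding contract_def
proof (rule continuous_on_vec_lambda)
  show "continuous_on S (\<lambda>p. if i = k then a $ k + of_real (snd p) * (fst p $ k - a $ k) else fst p $ i)" for i
    by (cases "i = k") (auto intro!: continuous_intros)
qed

lemma continuous_on_comp_contract:
  assumes "continuous_on (ball a r) f"
  shows "continuous_on (ball a r \<times> {0..1}) (\<lambda>p. f (contract a k (snd p) (fst p)))"
proof (rule continuous_on_compose2[OF assms continuous_on_contract])
  show "(\<lambda>p. contract a k (snd p) (fst p)) ` (ball a r \<times> {0..1}) \<subseteq> ball a r"
    by (auto simp: mem_Times_iff simp del: mem_ball intro!: contract_in_ball)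
qed

lemma has_vector_derivative_contract:
  "((\<lambda>t. contract a k t z) has_vector_derivative axis k (z $ k - a $ k)) (at t)"
proof -
  have "(\<lambda>t. contract a k t z) = (\<lambda>t. contract a k 0 z + t *\<^sub>R axis k (z $ k - a $ k))"
    by (auto simp: fun_eq_iff vec_eq_iff contract_def axis_def) (simp add: scaleR_conv_of_real)
  then show ?thesis by (auto intro!: derivative_eq_intros)
qed

text \<open>The primitive is the integral of \<open>f\<close> in the \<open>k\<close>-th variable
  from \<open>a $ k\<close> to \<open>z $ k\<close>, rescaled to the unit interval to fix the domain
  of integration. As the lower limit is constant, independence of another variable passes from
  \<open>f\<close> to the primitive.\<close>

lemma holo_on_primitive:
  fixes f :: "complex^'n \<Rightarrow> complex"
  assumes f: "f holo_on ball a r"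
  obtains g where "g holo_on ball a r" "\<And>z. z \<in> ball a r \<Longrightarrow> pd k g z = f z"
    "\<And>j z. j \<noteq> k \<Longrightarrow> (\<And>w. w \<in> ball a r \<Longrightarrow> pd j f w = 0) \<Longrightarrow> z \<in> ball a r \<Longrightarrow> pd j g z = 0"
proof -
  define \<phi> where "\<phi> z t = (z $ k - a $ k) * f (contract a k t z)" for z t
  have holo\<phi>: "(\<lambda>z. \<phi> z t) holo_on ball a r" if "t \<in> {0..1}" for t
    unfolding \<phi>_def by (intro holo_intros holo_on_comp_contract[OF f that])
  have pd\<phi>: "pd j (\<lambda>z. \<phi> z t) z =
      (if j = k then f (contract a k t z) + of_real t * ((z $ k - a $ k) * pd k f (contract a k t z))
       else (z $ k - a $ k) * pd j f (contract a k t z))"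
    if "t \<in> {0..1}" "z \<in> ball a r" for t z j
  proof -
    have "(\<lambda>z. f (contract a k t z)) holo_on {z}"
      by (rule holo_on_at[OF holo_on_comp_contract[OF f that(1)] that(2)])
    then show ?thesis
      unfolding \<phi>_def
      by (simp add: pd_mult pd_diff pd_const pd_coord holo_intros pd_comp_contract[OF f that])
  qed
  note cont_f = continuous_on_comp_contract[OF holo_on_continuous_on[OF f], of k]
  have cont_pd: "continuous_on (ball a r \<times> {0..1}) (\<lambda>p. pd j f (contract a k (snd p) (fst p)))" for j
    by (rule continuous_on_comp_contract[OF continuous_on_pd[OF open_ball f]])
  have cont\<phi>: "continuous_on (ball a r \<times> {0..1}) (\<lambda>(z, t). pd j (\<lambda>z. \<phi> z t) z)" for j
  proof -
    have "continuous_on (ball a r \<times> {0..1}) (\<lambda>p. if j = k then f (contract a k (snd p) (fst p)) +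
        of_real (snd p) * ((fst p $ k - a $ k) * pd k f (contract a k (snd p) (fst p)))
        else (fst p $ k - a $ k) * pd j f (contract a k (snd p) (fst p)))"
      by (cases "j = k") (auto intro!: continuous_intros cont_f cont_pd)
    then show ?thesis by (rule continuous_on_eq) (auto simp: pd\<phi>)
  qed
  have int: "\<phi> z integrable_on {0..1}" if z: "z \<in> ball a r" for z
  proof -
    have "continuous_on {0..1} (\<lambda>t. f (contract a k (snd (z, t)) (fst (z, t))))"
      by (rule continuous_on_compose2[OF cont_f]) (use z in \<open>auto intro!: continuous_on_Pair\<close>)
    then show ?thesis
      unfolding \<phi>_def by (intro integrable_continuous_real continuous_intros) simp
  qed
  note D = pd_integral[OF open_ball holo\<phi> int cont\<phi>]
  show thesis
  proof (rule that)
    show "(\<lambda>z. integral {0..1} (\<phi> z)) holo_on ball a r"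
      by (rule holo_on_integral[OF open_ball holo\<phi> int cont\<phi>])
  next
    fix z assume z: "z \<in> ball a r"
    \<comment> \<open>The \<open>k\<close>-th partial derivative of the integrand is the total
      \<open>t\<close>-derivative of \<open>t * f (contract a k t z)\<close>, so its integral is the
      boundary value \<open>f z\<close> at \<open>t = 1\<close>.\<close>
    have "((\<lambda>t. of_real t * f (contract a k t z)) has_vector_derivative pd k (\<lambda>z. \<phi> z t) z)
        (at t within {0..1})" if t: "t \<in> {0..1}" for t
    proof -
      have "((\<lambda>t. contract a k t z) has_derivative (\<lambda>s. s *\<^sub>R axis k (z $ k - a $ k))) (at t)"
        using has_vector_derivative_contract unfolding has_vector_derivative_def .
      from has_derivative_compose[OF this holo_on_has_derivative[OF f contract_in_ball[OF z t]]]
      have "((\<lambda>t. f (contract a k t z)) has_derivative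
          (\<lambda>s. \<Sum>i\<in>UNIV. (s *\<^sub>R axis k (z $ k - a $ k)) $ i * pd i f (contract a k t z))) (at t)" .
      moreover have "(\<Sum>i\<in>UNIV. (s *\<^sub>R axis k (z $ k - a $ k)) $ i * pd i f (contract a k t z)) =
          s *\<^sub>R ((z $ k - a $ k) * pd k f (contract a k t z))" for s
      proof -
        have "(\<Sum>i\<in>UNIV. (s *\<^sub>R axis k (z $ k - a $ k)) $ i * pd i f (contract a k t z)) =
          (\<Sum>i\<in>UNIV. if i = k then s *\<^sub>R ((z $ k - a $ k) * pd k f (contract a k t z)) else 0)"
          by (intro sum.cong) (auto simp: axis_def)
        then show ?thesis by simp
      qed
      ultimately have "((\<lambda>t. f (contract a k t z)) has_vector_derivative
          (z $ k - a $ k) * pd k f (contract a k t z)) (at t)"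
        unfolding has_vector_derivative_def by simp
      then have "((\<lambda>t. of_real t * f (contract a k t z)) has_vector_derivative
          of_real t * ((z $ k - a $ k) * pd k f (contract a k t z)) + 1 * f (contract a k t z)) (at t)"
        by (intro has_vector_derivative_mult) (auto intro!: derivative_eq_intros)
      then show ?thesis
        by (simp add: pd\<phi>[OF t z] add.commute has_vector_derivative_at_within)
    qed
    then have "((\<lambda>t. pd k (\<lambda>z. \<phi> z t) z) has_integral
        of_real 1 * f (contract a k 1 z) - of_real 0 * f (contract a k 0 z)) {0..1}"
      by (intro fundamental_theorem_of_calculus) auto
    moreover have "contract a k 1 z = z" by (simp add: contract_def vec_eq_iff)
    ultimately show "pd k (\<lambda>z. integral {0..1} (\<phi> z)) z = f z"
      using D[OF _ _ z] by (simp add: integral_unique)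
  next
    fix j z assume j: "j \<noteq> k" "\<And>w. w \<in> ball a r \<Longrightarrow> pd j f w = 0" and z: "z \<in> ball a r"
    have "pd j (\<lambda>z. \<phi> z t) z = 0" if "t \<in> {0..1}" for t
      using pd\<phi>[OF that z, of j] j(1) j(2)[OF contract_in_ball[OF z that]] by simp
    then have "integral {0..1} (\<lambda>t. pd j (\<lambda>z. \<phi> z t) z) = integral {0..1} (\<lambda>t::real. 0)"
      by (rule integral_cong)
    then show "pd j (\<lambda>z. integral {0..1} (\<phi> z)) z = 0"
      using D[OF _ _ z] by simp
  qed
qed

section \<open>The metric in heavenly coordinates\<close>

lemma sum_ix: "(\<Sum>a\<in>(UNIV :: ix set). f a) = f (Inl 1) + f (Inl 2) + f (Inr 1) + f (Inr 2)"
proof -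
  have "(\<Sum>a\<in>(UNIV :: ix set). f a) = (\<Sum>a\<in>UNIV <+> UNIV. f a)" by (simp add: UNIV_Plus_UNIV)
  also have "\<dots> = f (Inl 1) + f (Inl 2) + f (Inr 1) + f (Inr 2)"
    by (subst sum.Plus) (simp_all add: sum_2 add.assoc)
  finally show ?thesis .
qed

lemma all_ix: "(\<forall>a :: ix. P a) \<longleftrightarrow> P (Inl 1) \<and> P (Inl 2) \<and> P (Inr 1) \<and> P (Inr 2)"
  by (simp add: split_sum_all forall_2)

definition mat2 :: "complex \<Rightarrow> complex \<Rightarrow> complex \<Rightarrow> complex \<Rightarrow> complex^2^2" where
  "mat2 a b c d = vector [vector [a, b], vector [c, d]]"

lemma mat2_nth [simp]:
  "mat2 a b c d $ 1 $ 1 = a" "mat2 a b c d $ 1 $ 2 = b" "mat2 a b c d $ 2 $ 1 = c" "mat2 a b c d $ 2 $ 2 = d"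
  by (simp_all add: mat2_def)

lemma eta_nth [simp]: "eta $ 1 $ 1 = 0" "eta $ 1 $ 2 = 1" "eta $ 2 $ 1 = -1" "eta $ 2 $ 2 = 0"
  by (simp_all add: eta_def)

definition block :: "complex^2^2 \<Rightarrow> complex^2^2 \<Rightarrow> complex^2^2 \<Rightarrow> complex^2^2 \<Rightarrow> tens2" where
  "block A B C D = (\<chi> a b. case a of
     Inl i \<Rightarrow> (case b of Inl j \<Rightarrow> A $ i $ j | Inr j \<Rightarrow> B $ i $ j)
   | Inr i \<Rightarrow> (case b of Inl j \<Rightarrow> C $ i $ j | Inr j \<Rightarrow> D $ i $ j))"

lemma block_nth [simp]:
  "block A B C D $ Inl i $ Inl j = A $ i $ j" "block A B C D $ Inl i $ Inr j = B $ i $ j"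
  "block A B C D $ Inr i $ Inl j = C $ i $ j" "block A B C D $ Inr i $ Inr j = D $ i $ j"
  by (simp_all add: block_def)

lemma tens2_eq_iff: "(S :: tens2) = T \<longleftrightarrow> (\<forall>a b. S $ a $ b = T $ a $ b)"
  by (simp add: vec_eq_iff)

text \<open>The common shape of \<open>heavenly_metric\<close> and \<open>F_metric\<close>:
  \<open>p\<close>, \<open>q\<close>, \<open>r\<close> stand for the entries of the Hessian in
  \<open>y\<close>, and the halves in the mixed blocks come from \<open>\<odot>\<close>.\<close>

definition normal_metric :: "complex \<Rightarrow> complex \<Rightarrow> complex \<Rightarrow> tens2" where
  "normal_metric p q r = block (mat2 p q q r) (mat2 0 (-1/2) (1/2) 0) (mat2 0 (1/2) (-1/2) 0) 0"

definition normal_metric_inv :: "complex \<Rightarrow> complex \<Rightarrow> complex \<Rightarrow> tens2" where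
  "normal_metric_inv p q r = block 0 (mat2 0 (-2) 2 0) (mat2 0 2 (-2) 0) (4 *s mat2 (-r) q q (-p))"

lemma heavenly_metric_eq:
  assumes "pd (Inr 2) (pd (Inr 1) \<Theta>) z = pd (Inr 1) (pd (Inr 2) \<Theta>) z"
  shows "heavenly_metric \<Theta> z = normal_metric
    (pd (Inr 1) (pd (Inr 1) \<Theta>) z) (pd (Inr 1) (pd (Inr 2) \<Theta>) z) (pd (Inr 2) (pd (Inr 2) \<Theta>) z)"
  unfolding tens2_eq_iff all_ix
  by (simp add: heavenly_metric_def normal_metric_def sum_2 sym_prod_def dx_def dy_def axis_def assms)

lemma F_metric_eq:
  "F_metric F z = (let c = F (x_ratio z) / xdoty z ^ 3; x1 = z $ Inl 1; x2 = z $ Inl 2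
     in normal_metric (c * x2\<^sup>2) (- c * x1 * x2) (c * x1\<^sup>2))"
  unfolding tens2_eq_iff all_ix Let_def
  by (simp add: F_metric_def normal_metric_def sum_2 sym_prod_def dx_def dy_def axis_def power2_eq_square)

lemma normal_metric_inverse:
  "normal_metric p q r ** normal_metric_inv p q r = mat 1"
  "normal_metric_inv p q r ** normal_metric p q r = mat 1"
  unfolding tens2_eq_iff all_ix
  by (simp_all add: matrix_matrix_mult_def sum_ix normal_metric_def normal_metric_inv_def mat_def)

text \<open>\<open>matrix_inv\<close> is given by a choice. The explicit left inverse turns the
  right-inverse property of the chosen matrix into an equation.\<close>

lemma matrix_inv_normal_metric: "matrix_inv (normal_metric p q r) = normal_metric_inv p q r"
proof -
  let ?g = "normal_metric p q r" and ?h = "normal_metric_inv p q r"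
  have "?g ** matrix_inv ?g = mat 1"
    unfolding matrix_inv_def
    by (rule someI2[where a = ?h]) (simp_all add: normal_metric_inverse)
  then have "?h ** (?g ** matrix_inv ?g) = ?h" by simp
  then show ?thesis by (simp add: matrix_mul_assoc normal_metric_inverse)
qed

lemma xdoty_eq: "xdoty z = z $ Inl 1 * z $ Inr 2 - z $ Inl 2 * z $ Inr 1"
  by (simp add: xdoty_def sum_2)


section \<open>The Levi-Civita connection and the parallel complex structures\<close>

lemma christoffel_normal_metric:
  fixes p q r :: "pt \<Rightarrow> complex"
  assumes U: "open U" "z \<in> U" and g: "\<And>w. w \<in> U \<Longrightarrow> g w = normal_metric (p w) (q w) (r w)"
  defines "D \<equiv> \<lambda>c i j. pd c (\<lambda>w. mat2 (p w) (q w) (q w) (r w) $ i $ j) z"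
  shows "christoffel g z (Inl i) (Inl j) (Inl k) = (\<Sum>l\<in>UNIV. eta $ i $ l * D (Inr l) j k)"
    and "christoffel g z (Inl i) a (Inr k) = 0" "christoffel g z (Inl i) (Inr k) a = 0"
    and "christoffel g z (Inr i) (Inl j) (Inl k) =
      (\<Sum>l\<in>UNIV. eta $ i $ l * (D (Inl j) l k + D (Inl k) l j - D (Inl l) j k)) +
      2 * (\<Sum>l\<in>UNIV. mat2 (r z) (- q z) (- q z) (p z) $ i $ l * D (Inr l) j k)"
    and "christoffel g z (Inr i) (Inl j) (Inr k) = (\<Sum>l\<in>UNIV. eta $ i $ l * D (Inr k) l j)"
    and "christoffel g z (Inr i) (Inr k) (Inl j) = (\<Sum>l\<in>UNIV. eta $ i $ l * D (Inr k) l j)"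
    and "christoffel g z (Inr i) (Inr j) (Inr k) = 0"
proof -
  have pd_g: "pd c (\<lambda>w. g w $ a $ b) z = pd c (\<lambda>w. normal_metric (p w) (q w) (r w) $ a $ b) z" for a b c
    by (rule pd_cong_open[OF U]) (simp add: g)
  have inv: "matrix_inv (g z) = normal_metric_inv (p z) (q z) (r z)"
    using U by (simp add: g matrix_inv_normal_metric)
  note expand = christoffel_def sum_ix sum_2 pd_g inv normal_metric_def normal_metric_inv_def D_def pd_const
  \<comment> \<open>Quantifying over the indices lets \<open>forall_2\<close> split the claim into
    finitely many explicit computations; the other symbols are treated alike.\<close>
  have "\<forall>i j k. christoffel g z (Inl i) (Inl j) (Inl k) = (\<Sum>l\<in>UNIV. eta $ i $ l * D (Inr l) j k)"
    unfolding forall_2 by (simp add: expand)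
  then show "christoffel g z (Inl i) (Inl j) (Inl k) = (\<Sum>l\<in>UNIV. eta $ i $ l * D (Inr l) j k)" by simp
  \<comment> \<open>Geometrically, the distribution spanned by the
    \<open>\<partial>/\<partial>y\<close> is parallel.\<close>
  have "\<forall>a. \<forall>i k. christoffel g z (Inl i) a (Inr k) = 0 \<and> christoffel g z (Inl i) (Inr k) a = 0"
    unfolding all_ix forall_2 by (simp add: expand)
  then show "christoffel g z (Inl i) a (Inr k) = 0" "christoffel g z (Inl i) (Inr k) a = 0" by simp_all
  have "\<forall>i j k. christoffel g z (Inr i) (Inl j) (Inl k) =
      (\<Sum>l\<in>UNIV. eta $ i $ l * (D (Inl j) l k + D (Inl k) l j - D (Inl l) j k)) +
      2 * (\<Sum>l\<in>UNIV. mat2 (r z) (- q z) (- q z) (p z) $ i $ l * D (Inr l) j k)"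
    unfolding forall_2 by (simp add: expand; simp add: field_simps)
  then show "christoffel g z (Inr i) (Inl j) (Inl k) =
      (\<Sum>l\<in>UNIV. eta $ i $ l * (D (Inl j) l k + D (Inl k) l j - D (Inl l) j k)) +
      2 * (\<Sum>l\<in>UNIV. mat2 (r z) (- q z) (- q z) (p z) $ i $ l * D (Inr l) j k)" by simp
  have "\<forall>i j k. christoffel g z (Inr i) (Inl j) (Inr k) = (\<Sum>l\<in>UNIV. eta $ i $ l * D (Inr k) l j) \<and>
      christoffel g z (Inr i) (Inr k) (Inl j) = (\<Sum>l\<in>UNIV. eta $ i $ l * D (Inr k) l j)"
    unfolding forall_2 by (simp add: expand)
  then show "christoffel g z (Inr i) (Inl j) (Inr k) = (\<Sum>l\<in>UNIV. eta $ i $ l * D (Inr k) l j)"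
    "christoffel g z (Inr i) (Inr k) (Inl j) = (\<Sum>l\<in>UNIV. eta $ i $ l * D (Inr k) l j)" by simp_all
  have "\<forall>i j k. christoffel g z (Inr i) (Inr j) (Inr k) = 0"
    unfolding forall_2 by (simp add: expand)
  then show "christoffel g z (Inr i) (Inr j) (Inr k) = 0" by simp
qed

text \<open>With \<open>v\<^sub>i = \<partial>/\<partial>x\<^sup>i - (\<eta>H)\<^sup>k\<^sub>i \<partial>/\<partial>y\<^sup>k\<close>, these are \<open>I\<close>, which multiplies \<open>\<partial>/\<partial>y\<^sup>i\<close> by \<open>\<i>\<close> and \<open>v\<^sub>i\<close>
  by \<open>-\<i>\<close>, then \<open>J\<close>, which maps \<open>\<partial>/\<partial>y\<^sup>i\<close> to \<open>v\<^sub>i\<close> and \<open>v\<^sub>i\<close> to \<open>-\<partial>/\<partial>y\<^sup>i\<close>, and \<open>K = IJ\<close>.\<close>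

lemma heavenly_complex_structures_parallel:
  fixes p q r :: "pt \<Rightarrow> complex"
  assumes U: "open U" "z \<in> U" and g: "\<And>w. w \<in> U \<Longrightarrow> g w = normal_metric (p w) (q w) (r w)"
    and holo: "p holo_on {z}" "q holo_on {z}" "r holo_on {z}"
    and sym: "pd (Inr 2) p z = pd (Inr 1) q z" "pd (Inr 2) q z = pd (Inr 1) r z"
    and heavenly: "pd (Inl 2) p z = pd (Inl 1) q z + pd (Inr 1) (\<lambda>w. p w * r w - (q w)\<^sup>2) z"
      "pd (Inl 2) q z = pd (Inl 1) r z + pd (Inr 2) (\<lambda>w. p w * r w - (q w)\<^sup>2) z"
  shows "nabla g (\<lambda>w. block (mat2 (-\<i>) 0 0 (-\<i>)) 0
      (mat2 (2*\<i>*q w) (2*\<i>*r w) (-2*\<i>*p w) (-2*\<i>*q w)) (mat2 \<i> 0 0 \<i>)) z c = 0"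
    and "nabla g (\<lambda>w. block (mat2 (q w) (r w) (- p w) (- q w)) (mat2 1 0 0 1)
      (mat2 (p w * r w - (q w)\<^sup>2 - 1) 0 0 (p w * r w - (q w)\<^sup>2 - 1)) (mat2 (- q w) (- r w) (p w) (q w))) z c = 0"
    and "nabla g (\<lambda>w. block (mat2 (-\<i>*q w) (-\<i>*r w) (\<i>*p w) (\<i>*q w)) (mat2 (-\<i>) 0 0 (-\<i>))
      (mat2 (-\<i>*(p w * r w - (q w)\<^sup>2 + 1)) 0 0 (-\<i>*(p w * r w - (q w)\<^sup>2 + 1)))
      (mat2 (\<i>*q w) (\<i>*r w) (-\<i>*p w) (-\<i>*q w))) z c = 0"
proof -
  have simps: "pd c (\<lambda>w. p w * r w - (q w)\<^sup>2) z = pd c p z * r z + p z * pd c r z - 2 * q z * pd c q z" for c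
    by (simp add: pd_simps holo holo_intros)
  \<comment> \<open>Read from left to right, \<open>sym\<close> and \<open>heavenly'\<close>
    eliminate the dependent first derivatives of the Hessian; what remains of \<open>nabla\<close>
    are polynomial identities in the others.\<close>
  note heavenly' = heavenly[unfolded simps sym]
  note expand = nabla_def sum_ix sum_2 christoffel_normal_metric[OF U g] sym heavenly' pd_simps holo holo_intros
  have all: "(\<forall>c. nabla g T z c = 0) \<longleftrightarrow> (\<forall>c a b. nabla g T z c $ a $ b = 0)" for T
    by (simp add: tens2_eq_iff)
  have "\<forall>c. nabla g (\<lambda>w. block (mat2 (-\<i>) 0 0 (-\<i>)) 0
      (mat2 (2*\<i>*q w) (2*\<i>*r w) (-2*\<i>*p w) (-2*\<i>*q w)) (mat2 \<i> 0 0 \<i>)) z c = 0"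
    unfolding all all_ix by (simp add: expand; simp add: algebra_simps power2_eq_square)
  then show "nabla g (\<lambda>w. block (mat2 (-\<i>) 0 0 (-\<i>)) 0
      (mat2 (2*\<i>*q w) (2*\<i>*r w) (-2*\<i>*p w) (-2*\<i>*q w)) (mat2 \<i> 0 0 \<i>)) z c = 0" ..
  have "\<forall>c. nabla g (\<lambda>w. block (mat2 (q w) (r w) (- p w) (- q w)) (mat2 1 0 0 1)
      (mat2 (p w * r w - (q w)\<^sup>2 - 1) 0 0 (p w * r w - (q w)\<^sup>2 - 1)) (mat2 (- q w) (- r w) (p w) (q w))) z c = 0"
    unfolding all all_ix by (simp add: expand; simp add: algebra_simps power2_eq_square)
  then show "nabla g (\<lambda>w. block (mat2 (q w) (r w) (- p w) (- q w)) (mat2 1 0 0 1)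
      (mat2 (p w * r w - (q w)\<^sup>2 - 1) 0 0 (p w * r w - (q w)\<^sup>2 - 1)) (mat2 (- q w) (- r w) (p w) (q w))) z c = 0" ..
  have "\<forall>c. nabla g (\<lambda>w. block (mat2 (-\<i>*q w) (-\<i>*r w) (\<i>*p w) (\<i>*q w)) (mat2 (-\<i>) 0 0 (-\<i>))
      (mat2 (-\<i>*(p w * r w - (q w)\<^sup>2 + 1)) 0 0 (-\<i>*(p w * r w - (q w)\<^sup>2 + 1)))
      (mat2 (\<i>*q w) (\<i>*r w) (-\<i>*p w) (-\<i>*q w))) z c = 0"
    unfolding all all_ix by (simp add: expand; simp add: algebra_simps power2_eq_square)
  then show "nabla g (\<lambda>w. block (mat2 (-\<i>*q w) (-\<i>*r w) (\<i>*p w) (\<i>*q w)) (mat2 (-\<i>) 0 0 (-\<i>))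
      (mat2 (-\<i>*(p w * r w - (q w)\<^sup>2 + 1)) 0 0 (-\<i>*(p w * r w - (q w)\<^sup>2 + 1)))
      (mat2 (\<i>*q w) (\<i>*r w) (-\<i>*p w) (-\<i>*q w))) z c = 0" ..
qed

text \<open>A symmetric matrix that kills \<open>x \<noteq> 0\<close> is a multiple of the square of
  the covector \<open>(-x2, x1)\<close>. The covector takes the value \<open>s\<close> on
  \<open>y\<close>, so evaluating the matrix on \<open>(y, y)\<close> determines the multiple as
  \<open>t / s^2\<close>; for \<open>x = 0\<close> both sides vanish.\<close>

lemma rank_one_hessian:
  fixes a b c x1 x2 y1 y2 :: complex
  assumes "a * x1 + b * x2 = 0" "b * x1 + c * x2 = 0"
  defines "s \<equiv> x1 * y2 - x2 * y1" and "t \<equiv> a * y1\<^sup>2 + 2 * b * y1 * y2 + c * y2\<^sup>2"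
  shows "a * s\<^sup>2 = t * x2\<^sup>2" "b * s\<^sup>2 = - t * x1 * x2" "c * s\<^sup>2 = t * x1\<^sup>2"
  using assms(1,2) unfolding s_def t_def by algebra+

text \<open>The two transpositions generate all permutations of three derivatives.\<close>

lemma pd_commute3:
  fixes f :: "complex^'n \<Rightarrow> complex"
  assumes "open U" "f holo_on U" "z \<in> U"
  shows "pd i (pd j (pd k f)) z = pd i (pd k (pd j f)) z"
    and "pd i (pd j (pd k f)) z = pd k (pd j (pd i f)) z"
proof -
  have *: "pd i (pd j (pd k f)) z = pd i (pd k (pd j f)) z" for i j k
    by (rule pd_cong_open[OF assms(1,3)]) (rule pd_commute[OF assms(1,2)])
  have **: "pd i (pd j (pd k f)) z = pd j (pd i (pd k f)) z" for i j k
    by (rule pd_commute[OF assms(1) holo_on_pd[OF assms(1,2)] assms(3)])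
  show "pd i (pd j (pd k f)) z = pd i (pd k (pd j f)) z" by (rule *)
  show "pd i (pd j (pd k f)) z = pd k (pd j (pd i f)) z" using * ** by metis
qed

lemma heavenly_hessian_relations:
  assumes U: "open U" "\<Theta> holo_on U" and heavenly: "\<And>z. z \<in> U \<Longrightarrow> second_heavenly \<Theta> z"
  defines "p \<equiv> pd (Inr 1) (pd (Inr 1) \<Theta>)" and "q \<equiv> pd (Inr 1) (pd (Inr 2) \<Theta>)"
    and "r \<equiv> pd (Inr 2) (pd (Inr 2) \<Theta>)"
  assumes z: "z \<in> U"
  shows "pd (Inr 2) p z = pd (Inr 1) q z" "pd (Inr 2) q z = pd (Inr 1) r z"
    and "pd (Inl 2) p z = pd (Inl 1) q z + pd (Inr 1) (\<lambda>w. p w * r w - (q w)\<^sup>2) z"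
    and "pd (Inl 2) q z = pd (Inl 1) r z + pd (Inr 2) (\<lambda>w. p w * r w - (q w)\<^sup>2) z"
proof -
  note comm = pd_commute3[OF U z]
  show "pd (Inr 2) p z = pd (Inr 1) q z" "pd (Inr 2) q z = pd (Inr 1) r z"
    unfolding p_def q_def r_def using comm by metis+
  have "pd k (\<lambda>w. p w * r w - (q w)\<^sup>2) z =
      pd k (pd (Inr 1) (pd (Inl 2) \<Theta>)) z - pd k (pd (Inr 2) (pd (Inl 1) \<Theta>)) z" for k
  proof -
    have "pd k (\<lambda>w. p w * r w - (q w)\<^sup>2) z =
        pd k (\<lambda>w. pd (Inr 1) (pd (Inl 2) \<Theta>) w - pd (Inr 2) (pd (Inl 1) \<Theta>) w) z"
    proof (rule pd_cong_open[OF U(1) z])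
      fix w assume "w \<in> U"
      from heavenly[OF this]
      show "p w * r w - (q w)\<^sup>2 = pd (Inr 1) (pd (Inl 2) \<Theta>) w - pd (Inr 2) (pd (Inl 1) \<Theta>) w"
        unfolding second_heavenly_def p_def q_def r_def by algebra
    qed
    then show ?thesis
      using pd_diff[OF holo_on_at[OF holo_on_pd[OF U(1) holo_on_pd[OF U]] z]
          holo_on_at[OF holo_on_pd[OF U(1) holo_on_pd[OF U]] z]] by simp
  qed
  moreover have "pd (Inl 2) p z = pd (Inr 1) (pd (Inr 1) (pd (Inl 2) \<Theta>)) z"
    "pd (Inl 1) q z = pd (Inr 1) (pd (Inr 2) (pd (Inl 1) \<Theta>)) z"
    "pd (Inl 2) q z = pd (Inr 2) (pd (Inr 1) (pd (Inl 2) \<Theta>)) z"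
    "pd (Inl 1) r z = pd (Inr 2) (pd (Inr 2) (pd (Inl 1) \<Theta>)) z"
    unfolding p_def q_def r_def using comm by metis+
  ultimately show "pd (Inl 2) p z = pd (Inl 1) q z + pd (Inr 1) (\<lambda>w. p w * r w - (q w)\<^sup>2) z"
    "pd (Inl 2) q z = pd (Inl 1) r z + pd (Inr 2) (\<lambda>w. p w * r w - (q w)\<^sup>2) z"
    by simp_all
qed

section \<open>The conditions on \<open>W\<close> as equations for the Hessian\<close>

lemma W_nth [simp]: "W z $ Inl i = z $ Inl i" "W z $ Inr i = 0"
proof -
  have "W z $ Inl i = (\<Sum>j\<in>UNIV. if j = i then z $ Inl i else 0)"
    unfolding W_def sum_component by (intro sum.cong) (auto simp: axis_def)
  then show "W z $ Inl i = z $ Inl i" by simp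
  show "W z $ Inr i = 0" by (simp add: W_def axis_def)
qed

lemma normal_metric_inject:
  "normal_metric p q r = normal_metric p' q' r' \<longleftrightarrow> p = p' \<and> q = q' \<and> r = r'"
  unfolding tens2_eq_iff all_ix by (auto simp: normal_metric_def)

lemma apply2_W_normal_metric:
  "apply2 (normal_metric p q r) (W z) (W z) =
     p * (z $ Inl 1)\<^sup>2 + 2 * q * z $ Inl 1 * z $ Inl 2 + r * (z $ Inl 2)\<^sup>2"
  by (simp add: apply2_def sum_ix normal_metric_def power2_eq_square algebra_simps)

definition ddW :: "(pt \<Rightarrow> complex) \<Rightarrow> pt \<Rightarrow> complex" where
  "ddW f z = z $ Inl 1 * pd (Inl 1) f z + z $ Inl 2 * pd (Inl 2) f z"

text \<open>Along \<open>W\<close> the form \<open>dx i\<close> has degree 1 and \<open>dy i\<close>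
  degree 0, so the mixed part reproduces itself and the \<open>dx dx\<close> part gains
  \<open>2\<close>. Hence invariance up to scale says that the Hessian has degree -1.\<close>

lemma lie_deriv_normal_metric:
  assumes U: "open U" "z \<in> U" and g: "\<And>w. w \<in> U \<Longrightarrow> g w = normal_metric (p w) (q w) (r w)"
  shows "lie_deriv W g z = normal_metric (ddW p z + 2 * p z) (ddW q z + 2 * q z) (ddW r z + 2 * r z)"
proof -
  have pd_g: "pd c (\<lambda>w. g w $ a $ b) z = pd c (\<lambda>w. normal_metric (p w) (q w) (r w) $ a $ b) z" for a b c
    by (rule pd_cong_open[OF U]) (simp add: g)
  show ?thesis
    unfolding tens2_eq_iff all_ix
    by (simp add: lie_deriv_def sum_ix pd_g g[OF U(2)] normal_metric_def pd_simps ddW_def)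
qed

text \<open>The decisive strengthening: the scalar condition \<open>H(x, x) = 0\<close> is improved
  to \<open>H(x, _) = 0\<close>.\<close>

lemma homogeneous_null_hessian:
  fixes p q r :: "pt \<Rightarrow> complex"
  assumes U: "open U" and holo: "p holo_on U" "q holo_on U" "r holo_on U"
    and xdoty: "\<And>z. z \<in> U \<Longrightarrow> xdoty z \<noteq> 0"
    and sym: "\<And>z. z \<in> U \<Longrightarrow> pd (Inr 2) p z = pd (Inr 1) q z" "\<And>z. z \<in> U \<Longrightarrow> pd (Inr 2) q z = pd (Inr 1) r z"
    and heavenly: "\<And>z. z \<in> U \<Longrightarrow> pd (Inl 2) p z = pd (Inl 1) q z + pd (Inr 1) (\<lambda>w. p w * r w - (q w)\<^sup>2) z"
      "\<And>z. z \<in> U \<Longrightarrow> pd (Inl 2) q z = pd (Inl 1) r z + pd (Inr 2) (\<lambda>w. p w * r w - (q w)\<^sup>2) z"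
    and homog: "\<And>z. z \<in> U \<Longrightarrow> ddW p z = - p z" "\<And>z. z \<in> U \<Longrightarrow> ddW q z = - q z"
      "\<And>z. z \<in> U \<Longrightarrow> ddW r z = - r z"
    and null: "\<And>z. z \<in> U \<Longrightarrow> p z * (z $ Inl 1)\<^sup>2 + 2 * q z * z $ Inl 1 * z $ Inl 2 + r z * (z $ Inl 2)\<^sup>2 = 0"
    and z: "z \<in> U"
  shows "p z * z $ Inl 1 + q z * z $ Inl 2 = 0" "q z * z $ Inl 1 + r z * z $ Inl 2 = 0"
proof -
  note hz = holo_on_at[OF holo(1) z] holo_on_at[OF holo(2) z] holo_on_at[OF holo(3) z]
  define x1 x2 where "x1 = z $ Inl 1" and "x2 = z $ Inl 2"
  have pd_null: "pd k (\<lambda>z. p z * (z $ Inl 1)\<^sup>2 + 2 * q z * z $ Inl 1 * z $ Inl 2 + r z * (z $ Inl 2)\<^sup>2) z = 0" for k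
    using pd_cong_open[OF U z null, where k=k] by (simp add: pd_const)
  have D: "pd k (\<lambda>w. p w * r w - (q w)\<^sup>2) z = pd k p z * r z + p z * pd k r z - 2 * q z * pd k q z" for k
    by (simp add: pd_simps hz holo_intros)
  define a b c e where "a = pd (Inr 1) p z" and "b = pd (Inr 1) q z" and "c = pd (Inr 1) r z" and "e = pd (Inr 2) r z"
  define d1 d2 where "d1 = a * r z + p z * c - 2 * q z * b" and "d2 = b * r z + p z * e - 2 * q z * c"
  have y: "a * x1\<^sup>2 + 2 * b * x1 * x2 + c * x2\<^sup>2 = 0" "b * x1\<^sup>2 + 2 * c * x1 * x2 + e * x2\<^sup>2 = 0"
    using pd_null[of "Inr 1"] pd_null[of "Inr 2"]
    by (simp_all add: pd_simps hz holo_intros a_def b_def c_def e_def x1_def x2_def sym[OF z])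
  have h: "pd (Inl 2) p z = pd (Inl 1) q z + d1" "pd (Inl 2) q z = pd (Inl 1) r z + d2"
    using heavenly[OF z] by (simp_all add: D d1_def d2_def a_def b_def c_def e_def sym[OF z])
  have w: "x1 * pd (Inl 1) p z + x2 * pd (Inl 2) p z = - p z"
    "x1 * pd (Inl 1) q z + x2 * pd (Inl 2) q z = - q z"
    "x1 * pd (Inl 1) r z + x2 * pd (Inl 2) r z = - r z"
    using homog[OF z] by (simp_all add: ddW_def x1_def x2_def)
  \<comment> \<open>The left side is \<open>E (det H)\<close>, the trace of the adjugate of
    \<open>H\<close> times \<open>E H\<close>. By \<open>S\<close> the matrix \<open>E H\<close>
    kills \<open>x\<close>, so it is a multiple of the square of \<open>(-x2, x1)\<close>, and the
    trace becomes a multiple of \<open>H(x, x) = 0\<close>. The factor \<open>(x\<cdot>y)^2\<close>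
    from \<open>rank_one_hessian\<close> is cancelled at the end.\<close>
  have E: "x1 * d1 + x2 * d2 = 0"
  proof -
    have S: "(a * x1 + b * x2) * x1 + (b * x1 + c * x2) * x2 = 0"
      "(b * x1 + c * x2) * x1 + (c * x1 + e * x2) * x2 = 0"
      using y by algebra+
    have "(x1 * d1 + x2 * d2) * (xdoty z)\<^sup>2 = 0"
      using rank_one_hessian[OF S, of "z $ Inr 2" "z $ Inr 1"] null[OF z]
      unfolding xdoty_eq d1_def d2_def x1_def[symmetric] x2_def[symmetric] by algebra
    then show ?thesis using xdoty[OF z] by simp
  qed
  have x: "pd (Inl 1) p z * x1\<^sup>2 + 2 * p z * x1 + 2 * pd (Inl 1) q z * x1 * x2 + 2 * q z * x2
      + pd (Inl 1) r z * x2\<^sup>2 = 0"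
    "pd (Inl 2) p z * x1\<^sup>2 + 2 * pd (Inl 2) q z * x1 * x2 + 2 * q z * x1
      + pd (Inl 2) r z * x2\<^sup>2 + 2 * r z * x2 = 0"
    using pd_null[of "Inl 1"] pd_null[of "Inl 2"]
    by (simp_all add: pd_simps hz holo_intros x1_def x2_def algebra_simps)
  \<comment> \<open>Exchanging \<open>x\<close>-derivatives by \<open>h\<close> turns the derivative
    terms of the first equation of \<open>x\<close> into \<open>x1 * W p + x2 * W q\<close>, up to a
    multiple of \<open>E\<close>. By homogeneity this is \<open>- (p x1 + q x2)\<close>, which
    leaves one of the two copies of \<open>p x1 + q x2\<close> already present. The second equation
    works in the same way.\<close>
  show "p z * z $ Inl 1 + q z * z $ Inl 2 = 0" "q z * z $ Inl 1 + r z * z $ Inl 2 = 0"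
    using x w h E unfolding x1_def[symmetric] x2_def[symmetric] by algebra+
qed

text \<open>The explicit structures \<open>I\<close>, \<open>J\<close>, \<open>K\<close> witness the
  quaternion action. Since \<open>K = I J\<close>, the relation \<open>K^2 = -1\<close> already
  contains the anticommutation of \<open>I\<close> and \<open>J\<close>.\<close>

lemma heavenly_hyperkaehler:
  assumes U: "open U" "\<Theta> holo_on U" and heavenly: "\<And>z. z \<in> U \<Longrightarrow> second_heavenly \<Theta> z"
    and g: "\<And>z. z \<in> U \<Longrightarrow> g z = heavenly_metric \<Theta> z"
  shows "complex_hyperkaehler_on g U"
proof -
  define p q r where "p = pd (Inr 1) (pd (Inr 1) \<Theta>)" and "q = pd (Inr 1) (pd (Inr 2) \<Theta>)"
    and "r = pd (Inr 2) (pd (Inr 2) \<Theta>)"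
  have holo: "p holo_on U" "q holo_on U" "r holo_on U"
    unfolding p_def q_def r_def by (intro holo_on_pd U)+
  have g_eq: "g z = normal_metric (p z) (q z) (r z)" if "z \<in> U" for z
    unfolding g[OF that] p_def q_def r_def by (rule heavenly_metric_eq[OF pd_commute[OF U that]])
  have metric: "holo_metric_on g U"
    unfolding holo_metric_on_def
  proof (intro conjI ballI)
    have *: "\<forall>a b. (\<lambda>z. normal_metric (p z) (q z) (r z) $ a $ b) holo_on U"
      unfolding all_ix by (simp add: normal_metric_def holo holo_on_const)
    have "(\<lambda>z. g z $ a $ b) holo_on U" for a b
      by (subst holo_on_cong[OF U(1), where g = "\<lambda>z. normal_metric (p z) (q z) (r z) $ a $ b"])
         (simp_all add: g_eq *[rule_format])
    then show "holo_field_on g U" unfolding holo_field_on_def by simp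
    fix z assume z: "z \<in> U"
    show "transpose (g z) = g z"
      unfolding g_eq[OF z] by (simp add: tens2_eq_iff all_ix transpose_def normal_metric_def)
    show "invertible (g z)"
      unfolding g_eq[OF z] invertible_def using normal_metric_inverse[of "p z" "q z" "r z"] by blast
  qed
  define I where "I = (\<lambda>w. block (mat2 (-\<i>) 0 0 (-\<i>)) 0
      (mat2 (2*\<i>*q w) (2*\<i>*r w) (-2*\<i>*p w) (-2*\<i>*q w)) (mat2 \<i> 0 0 \<i>))"
  define J where "J = (\<lambda>w. block (mat2 (q w) (r w) (- p w) (- q w)) (mat2 1 0 0 1)
      (mat2 (p w * r w - (q w)\<^sup>2 - 1) 0 0 (p w * r w - (q w)\<^sup>2 - 1)) (mat2 (- q w) (- r w) (p w) (q w)))"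
  define K where "K = (\<lambda>w. block (mat2 (-\<i>*q w) (-\<i>*r w) (\<i>*p w) (\<i>*q w)) (mat2 (-\<i>) 0 0 (-\<i>))
      (mat2 (-\<i>*(p w * r w - (q w)\<^sup>2 + 1)) 0 0 (-\<i>*(p w * r w - (q w)\<^sup>2 + 1)))
      (mat2 (\<i>*q w) (\<i>*r w) (-\<i>*p w) (-\<i>*q w)))"
  have field: "holo_field_on I U" "holo_field_on J U" "holo_field_on K U"
    unfolding holo_field_on_def all_ix I_def J_def K_def
    by (simp_all add: holo holo_intros)
  have square: "I z ** I z = - mat 1" "J z ** J z = - mat 1" "K z ** K z = - mat 1" "I z ** J z = K z" for z
    unfolding tens2_eq_iff all_ix I_def J_def K_def
    by (simp_all add: matrix_matrix_mult_def sum_ix mat_def; simp add: algebra_simps power2_eq_square)+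
  have compat: "transpose (I z) ** g z ** I z = g z" "transpose (J z) ** g z ** J z = g z"
    "transpose (K z) ** g z ** K z = g z" if "z \<in> U" for z
    unfolding tens2_eq_iff all_ix I_def J_def K_def g_eq[OF that] normal_metric_def
    by (simp_all add: matrix_matrix_mult_def transpose_def sum_ix; simp add: field_simps power2_eq_square)+
  have parallel: "nabla g I z c = 0" "nabla g J z c = 0" "nabla g K z c = 0" if "z \<in> U" for z c
    unfolding I_def J_def K_def
    using heavenly_complex_structures_parallel[OF U(1) that g_eq holo_on_at[OF holo(1) that]
        holo_on_at[OF holo(2) that] holo_on_at[OF holo(3) that]
        heavenly_hessian_relations[OF U heavenly that, folded p_def q_def r_def]]
    by simp_all
  show ?thesis
    unfolding complex_hyperkaehler_on_def
  proof (rule conjI[OF metric], rule exI[of _ I], rule exI[of _ J], rule exI[of _ K], rule conjI)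
    show "\<forall>T\<in>{I, J, K}. holo_field_on T U \<and> (\<forall>z\<in>U. T z ** T z = - mat 1 \<and>
        transpose (T z) ** g z ** T z = g z \<and> (\<forall>c. nabla g T z c = 0))"
      by (simp add: field square compat parallel)
    show "\<forall>z\<in>U. I z ** J z = K z" by (simp add: square)
  qed
qed

section \<open>Homogeneous solutions descend to the leaf space\<close>

definition ddE :: "(pt \<Rightarrow> complex) \<Rightarrow> pt \<Rightarrow> complex" where
  "ddE f z = z $ Inl 1 * pd (Inr 1) f z + z $ Inl 2 * pd (Inr 2) f z"

lemma continuous_on_holo_components:
  fixes m :: "complex^'m \<Rightarrow> complex^'n"
  assumes "\<And>j. (\<lambda>z. m z $ j) holo_on U"
  shows "continuous_on U m"
proof -
  have "continuous_on U (\<lambda>z. \<chi> j. m z $ j)"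
    using holo_on_continuous_on[OF assms] by (rule continuous_on_vec_lambda)
  then show ?thesis by simp
qed

lemma xdoty_fun: "xdoty = (\<lambda>z. z $ Inl 1 * z $ Inr 2 - z $ Inl 2 * z $ Inr 1)"
  by (rule ext) (rule xdoty_eq)

lemma holo_on_xdoty: "xdoty holo_on U"
  unfolding xdoty_fun by (intro holo_intros)

lemma pd_xdoty:
  "pd (Inl 1) xdoty z = z $ Inr 2" "pd (Inl 2) xdoty z = - z $ Inr 1"
  "pd (Inr 1) xdoty z = - z $ Inl 2" "pd (Inr 2) xdoty z = z $ Inl 1"
  unfolding xdoty_fun by (simp_all add: pd_simps holo_intros)

lemma holo_on_x_ratio: "(\<And>z. z \<in> U \<Longrightarrow> xdoty z \<noteq> 0) \<Longrightarrow> (\<lambda>z. x_ratio z $ i) holo_on U"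
  unfolding x_ratio_def by (auto intro: holo_on_divide holo_on_coord holo_on_xdoty)

text \<open>The leaves are the fibres of \<open>x_ratio\<close>. A point of the fibre over \<open>u\<close> is joined by a segment
  inside the fibre to the value at \<open>u\<close> of the section \<open>s\<close> through \<open>z0\<close>.\<close>

lemma constant_on_leaves:
  assumes U: "open U" "z0 \<in> U" and xdoty: "\<And>z. z \<in> U \<Longrightarrow> xdoty z \<noteq> 0"
    and G: "G holo_on U" "\<And>z. z \<in> U \<Longrightarrow> ddW G z = 0" "\<And>z. z \<in> U \<Longrightarrow> ddE G z = 0"
  obtains N V F where "open N" "z0 \<in> N" "N \<subseteq> U" "open V" "F holo_on V" "x_ratio ` N \<subseteq> V"
    "\<forall>z\<in>N. G z = F (x_ratio z)"
proof -
  obtain e where e: "e > 0" "ball z0 e \<subseteq> U" using U openE by blast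
  let ?B = "ball z0 e"
  \<comment> \<open>The section keeps \<open>y\<close> proportional to its value at
    \<open>z0\<close>. Dividing it by \<open>L u\<close> makes \<open>x\<cdot>y\<close> constant on
    the section, so that \<open>x_ratio (s u) = u\<close>; at \<open>z0\<close> the factor is 1 and
    the section passes through \<open>z0\<close>.\<close>
  define L where "L u = u $ 1 * z0 $ Inr 2 - u $ 2 * z0 $ Inr 1" for u :: "complex^2"
  define s :: "complex^2 \<Rightarrow> pt" where
    "s u = (\<chi> a. case a of Inl i \<Rightarrow> xdoty z0 * u $ i | Inr i \<Rightarrow> z0 $ Inr i / L u)" for u
  have s_nth: "s u $ Inl i = xdoty z0 * u $ i" "s u $ Inr i = z0 $ Inr i / L u" for u i
    by (simp_all add: s_def)
  have L: "L holo_on S" for S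
    unfolding L_def by (intro holo_intros)
  have s: "(\<lambda>u. s u $ a) holo_on {u. L u \<noteq> 0}" for a
    by (cases a) (auto simp: s_nth intro!: holo_intros L)
  have "open (L -` (- {0}))"
    using continuous_open_preimage[OF holo_on_continuous_on[OF L], of UNIV "- {0}"] by (simp add: open_Compl)
  then have "open {u. L u \<noteq> 0}" by (simp add: vimage_def)
  then have V: "open ({u. L u \<noteq> 0} \<inter> s -` ?B)"
    using continuous_open_preimage[OF continuous_on_holo_components[OF s]] by blast
  have xr: "(\<lambda>z. x_ratio z $ i) holo_on ?B" for i
    using e xdoty by (intro holo_on_x_ratio) blast
  have N: "open (?B \<inter> x_ratio -` ({u. L u \<noteq> 0} \<inter> s -` ?B))"
    using continuous_open_preimage[OF continuous_on_holo_components[OF xr] open_ball V] .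
  have "L (x_ratio z0) = 1"
    using xdoty[OF U(2)] by (simp add: L_def x_ratio_def xdoty_eq diff_divide_distrib[symmetric])
  moreover from this have "s (x_ratio z0) = z0"
    unfolding vec_eq_iff[of "s _"] using xdoty[OF U(2)]
    by (simp add: split_sum_all s_nth x_ratio_def)
  ultimately have z0: "z0 \<in> ?B \<inter> x_ratio -` ({u. L u \<noteq> 0} \<inter> s -` ?B)"
    using e by simp
  have "G z = G (s (x_ratio z))" if z: "z \<in> ?B" "x_ratio z \<in> {u. L u \<noteq> 0} \<inter> s -` ?B" for z
  proof -
    define u where "u = x_ratio z"
    define w where "w = s u"
    have w: "w \<in> ?B" and Lu: "L u \<noteq> 0" using z by (auto simp: w_def u_def)
    have xz: "xdoty z \<noteq> 0" using z(1) e xdoty by blast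
    have zu: "z $ Inl i = xdoty z * u $ i" for i using xz by (simp add: u_def x_ratio_def)
    define v where "v = z - w"
    have vx: "v $ Inl i = (xdoty z - xdoty z0) * u $ i" for i
      by (simp add: v_def zu[of i] w_def s_nth left_diff_distrib)
    have uy: "u $ 1 * z $ Inr 2 - u $ 2 * z $ Inr 1 = 1"
    proof -
      have "xdoty z * (u $ 1 * z $ Inr 2 - u $ 2 * z $ Inr 1) = xdoty z * 1"
        using xdoty_eq[of z] zu[of 1] zu[of 2] by algebra
      then show ?thesis using xz by (simp only: mult_cancel_left) simp
    qed
    have "u $ 1 * w $ Inr 2 - u $ 2 * w $ Inr 1 = 1"
      using Lu by (simp add: w_def s_nth L_def diff_divide_distrib[symmetric])
    then have uv: "u $ 1 * v $ Inr 2 - u $ 2 * v $ Inr 1 = 0"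
      using uy by (simp add: v_def algebra_simps)
    \<comment> \<open>By \<open>uv\<close> the \<open>y\<close>-part of \<open>v\<close> is a
      multiple of \<open>u\<close>. Pairing it with the \<open>y\<close>-part of \<open>z\<close>
      gives the coefficient, because \<open>u\<cdot>y = 1\<close> there by
      \<open>uy\<close>.\<close>
    define t where "t = v $ Inr 1 * z $ Inr 2 - v $ Inr 2 * z $ Inr 1"
    have vy: "v $ Inr 1 = t * u $ 1" "v $ Inr 2 = t * u $ 2"
      using uy uv unfolding t_def by algebra+
    have "((\<lambda>\<tau>. G (w + \<tau> *\<^sub>R v)) has_vector_derivative 0) (at \<tau> within {0..1})"
      if \<tau>: "\<tau> \<in> {0..1}" for \<tau>
    proof -
      define P where "P = w + \<tau> *\<^sub>R v"
      have "P = (1 - \<tau>) *\<^sub>R w + \<tau> *\<^sub>R z" by (simp add: P_def v_def algebra_simps)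
      then have "P \<in> ?B"
        using \<tau> convexD[OF convex_ball[of z0 e] w z(1), of "1 - \<tau>" \<tau>] by simp
      then have P: "P \<in> U" using e by blast
      define \<sigma> where "\<sigma> = xdoty z0 + of_real \<tau> * (xdoty z - xdoty z0)"
      have Px: "P $ Inl i = \<sigma> * u $ i" for i
        by (simp add: P_def \<sigma>_def vx w_def s_nth scaleR_conv_of_real[of \<tau> "_ :: complex"] algebra_simps)
      \<comment> \<open>If \<open>\<sigma>\<close> vanished, so would \<open>x\<cdot>y\<close> at
        \<open>P\<close>, although \<open>P\<close> lies in \<open>U\<close>. Hence
        \<open>\<sigma>\<close> may be divided out, and both equations hold in direction
        \<open>u\<close>, to which the two halves of \<open>v\<close> are proportional.\<close>
      have "\<sigma> \<noteq> 0" using xdoty[OF P] by (auto simp: xdoty_eq Px)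
      then have D: "u $ 1 * pd (Inl 1) G P + u $ 2 * pd (Inl 2) G P = 0"
        "u $ 1 * pd (Inr 1) G P + u $ 2 * pd (Inr 2) G P = 0"
        using G(2,3)[OF P] by (simp_all add: ddW_def ddE_def Px mult.assoc distrib_left[symmetric])
      have "(\<Sum>k\<in>UNIV. v $ k * pd k G P) = 0"
        using D unfolding sum_ix vx vy by algebra
      then have "(\<Sum>k\<in>UNIV. (h *\<^sub>R v) $ k * pd k G P) = 0" for h
        by (simp add: scaleR_sum_right[symmetric])
      moreover have "((\<lambda>\<tau>. w + \<tau> *\<^sub>R v) has_derivative (\<lambda>h. h *\<^sub>R v)) (at \<tau> within {0..1})"
        by (auto intro!: derivative_eq_intros)
      from has_derivative_compose[OF this holo_on_has_derivative[OF G(1) P, unfolded P_def]]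
      have "((\<lambda>\<tau>. G (w + \<tau> *\<^sub>R v)) has_derivative (\<lambda>h. \<Sum>k\<in>UNIV. (h *\<^sub>R v) $ k * pd k G P)) (at \<tau> within {0..1})"
        by (simp add: P_def)
      ultimately show ?thesis by (simp add: has_vector_derivative_def)
    qed
    then obtain c where "\<And>\<tau>. \<tau> \<in> {0..1} \<Longrightarrow> G (w + \<tau> *\<^sub>R v) = c"
      using has_vector_derivative_zero_constant[of "{0..1}" "\<lambda>\<tau>. G (w + \<tau> *\<^sub>R v)"] by auto
    from this[of 0] this[of 1] have "G w = G (w + v)" by simp
    then show ?thesis by (simp add: v_def w_def u_def)
  qed
  moreover have "(\<lambda>u. G (s u)) holo_on {u. L u \<noteq> 0} \<inter> s -` ?B"
    by (rule holo_on_compose[OF G(1)]) (use holo_on_subset[OF s] e in auto)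
  ultimately show thesis
    using N z0 e V
    by (intro that[of "?B \<inter> x_ratio -` ({u. L u \<noteq> 0} \<inter> s -` ?B)" "{u. L u \<noteq> 0} \<inter> s -` ?B" "\<lambda>u. G (s u)"]) auto
qed

text \<open>Once \<open>H(x, _) = 0\<close>, the Hessian is determined by \<open>H(y, y)\<close>
  alone, and a suitable multiple of this number descends to the leaf space, where it is
  \<open>F\<close>.\<close>

lemma homogeneous_null_heavenly_metric:
  assumes U: "open U" "\<Theta> holo_on U" and g: "\<And>z. z \<in> U \<Longrightarrow> g z = heavenly_metric \<Theta> z"
    and heavenly: "\<And>z. z \<in> U \<Longrightarrow> second_heavenly \<Theta> z"
    and lie: "\<And>z. z \<in> U \<Longrightarrow> lie_deriv W g z = g z"
    and null: "\<And>z. z \<in> U \<Longrightarrow> apply2 (g z) (W z) (W z) = 0"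
    and xdoty: "\<And>z. z \<in> U \<Longrightarrow> xdoty z \<noteq> 0" and z0: "z0 \<in> U"
  obtains N V F where "open N" "z0 \<in> N" "N \<subseteq> U" "open V" "F holo_on V" "x_ratio ` N \<subseteq> V"
    "\<forall>z\<in>N. g z = F_metric F z"
proof -
  define p q r where "p = pd (Inr 1) (pd (Inr 1) \<Theta>)" and "q = pd (Inr 1) (pd (Inr 2) \<Theta>)"
    and "r = pd (Inr 2) (pd (Inr 2) \<Theta>)"
  have holo: "p holo_on U" "q holo_on U" "r holo_on U"
    unfolding p_def q_def r_def by (intro holo_on_pd U)+
  have g_eq: "g z = normal_metric (p z) (q z) (r z)" if "z \<in> U" for z
    unfolding g[OF that] p_def q_def r_def by (rule heavenly_metric_eq[OF pd_commute[OF U that]])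
  have rel: "pd (Inr 2) p z = pd (Inr 1) q z" "pd (Inr 2) q z = pd (Inr 1) r z"
    "pd (Inl 2) p z = pd (Inl 1) q z + pd (Inr 1) (\<lambda>w. p w * r w - (q w)\<^sup>2) z"
    "pd (Inl 2) q z = pd (Inl 1) r z + pd (Inr 2) (\<lambda>w. p w * r w - (q w)\<^sup>2) z" if "z \<in> U" for z
    using heavenly_hessian_relations[OF U heavenly that] unfolding p_def q_def r_def by simp_all
  have homog: "ddW p z = - p z" "ddW q z = - q z" "ddW r z = - r z" if "z \<in> U" for z
    using lie[OF that] lie_deriv_normal_metric[where p = p and q = q and r = r, OF U(1) that g_eq] g_eq[OF that]
    by (auto simp: normal_metric_inject eq_neg_iff_add_eq_0 add.commute)
  have null': "p z * (z $ Inl 1)\<^sup>2 + 2 * q z * z $ Inl 1 * z $ Inl 2 + r z * (z $ Inl 2)\<^sup>2 = 0"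
    if "z \<in> U" for z
    using null[OF that] unfolding g_eq[OF that] apply2_W_normal_metric .
  have h1: "p z * z $ Inl 1 + q z * z $ Inl 2 = 0" if "z \<in> U" for z
    by (rule homogeneous_null_hessian(1)[OF U(1) holo]; (erule xdoty rel homog null' | rule that))
  have h2: "q z * z $ Inl 1 + r z * z $ Inl 2 = 0" if "z \<in> U" for z
    by (rule homogeneous_null_hessian(2)[OF U(1) holo]; (erule xdoty rel homog null' | rule that))
  note h = h1 h2
  \<comment> \<open>The factor \<open>x\<cdot>y\<close> of degree 1 along \<open>W\<close> balances
    the degree -1 of \<open>H\<close>. Since \<open>E\<close> sends \<open>y\<close> to
    \<open>x\<close> and kills \<open>x\<cdot>y\<close>, \<open>E G\<close> only involves
    \<open>H(x, y)\<close> and \<open>y\<close>-derivatives of \<open>H(x, _)\<close>, which all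
    vanish.\<close>
  define G where "G z = xdoty z * (p z * (z $ Inr 1)\<^sup>2 + 2 * q z * z $ Inr 1 * z $ Inr 2 + r z * (z $ Inr 2)\<^sup>2)" for z
  have G: "G holo_on U"
    unfolding G_def by (intro holo_intros holo holo_on_xdoty)
  have dG: "ddW G z = 0" "ddE G z = 0" if z: "z \<in> U" for z
  proof -
    note hz = holo_on_at[OF holo(1) z] holo_on_at[OF holo(2) z] holo_on_at[OF holo(3) z]
    have h_pd: "pd k (\<lambda>w. p w * w $ Inl 1 + q w * w $ Inl 2) z = 0"
      "pd k (\<lambda>w. q w * w $ Inl 1 + r w * w $ Inl 2) z = 0" for k
      using pd_cong_open[where g = "\<lambda>_. 0" and k = k, OF U(1) z] h by (simp_all add: pd_const)
    have S: "pd (Inr 1) p z * z $ Inl 1 + pd (Inr 1) q z * z $ Inl 2 = 0"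
      "pd (Inr 1) q z * z $ Inl 1 + pd (Inr 1) r z * z $ Inl 2 = 0"
      "pd (Inr 2) p z * z $ Inl 1 + pd (Inr 2) q z * z $ Inl 2 = 0"
      "pd (Inr 2) q z * z $ Inl 1 + pd (Inr 2) r z * z $ Inl 2 = 0"
      using h_pd[of "Inr 1"] h_pd[of "Inr 2"] by (simp_all add: pd_simps hz holo_intros)
    have "ddE G z = xdoty z * (
        (pd (Inr 1) p z * z $ Inl 1 + pd (Inr 1) q z * z $ Inl 2) * (z $ Inr 1)\<^sup>2
        + 2 * (pd (Inr 1) q z * z $ Inl 1 + pd (Inr 1) r z * z $ Inl 2) * z $ Inr 1 * z $ Inr 2
        + (pd (Inr 2) q z * z $ Inl 1 + pd (Inr 2) r z * z $ Inl 2) * (z $ Inr 2)\<^sup>2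
        + 2 * (p z * z $ Inl 1 + q z * z $ Inl 2) * z $ Inr 1
        + 2 * (q z * z $ Inl 1 + r z * z $ Inl 2) * z $ Inr 2)"
      unfolding ddE_def G_def
      by (simp add: pd_simps hz holo_intros holo_on_xdoty pd_xdoty rel(1,2)[OF z])
         (simp add: algebra_simps power2_eq_square)
    then show "ddE G z = 0" by (simp add: S h[OF z])
    have "ddW G z = xdoty z * ((ddW p z + p z) * (z $ Inr 1)\<^sup>2
        + 2 * (ddW q z + q z) * z $ Inr 1 * z $ Inr 2 + (ddW r z + r z) * (z $ Inr 2)\<^sup>2)"
      unfolding ddW_def G_def
      by (simp add: pd_simps hz holo_intros holo_on_xdoty pd_xdoty)
         (simp add: xdoty_eq algebra_simps power2_eq_square)
    then show "ddW G z = 0" by (simp add: homog[OF z])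
  qed
  obtain N V F where N: "open N" "z0 \<in> N" "N \<subseteq> U" "open V" "F holo_on V" "x_ratio ` N \<subseteq> V"
    "\<forall>z\<in>N. G z = F (x_ratio z)"
    by (rule constant_on_leaves[OF U(1) z0 xdoty G dG])
  have "g z = F_metric F z" if "z \<in> N" for z
  proof -
    have z: "z \<in> U" using N that by blast
    define t where "t = p z * (z $ Inr 1)\<^sup>2 + 2 * q z * z $ Inr 1 * z $ Inr 2 + r z * (z $ Inr 2)\<^sup>2"
    have pqr: "p z * (xdoty z)\<^sup>2 = t * (z $ Inl 2)\<^sup>2" "q z * (xdoty z)\<^sup>2 = - t * z $ Inl 1 * z $ Inl 2"
      "r z * (xdoty z)\<^sup>2 = t * (z $ Inl 1)\<^sup>2"
      unfolding t_def xdoty_eq by (rule rank_one_hessian[OF h[OF z]])+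
    \<comment> \<open>\<open>F = G = (x\<cdot>y) * t\<close>, which explains the cube in the final
      metric: one power from \<open>G\<close> and two from \<open>rank_one_hessian\<close>.\<close>
    have c: "F (x_ratio z) / xdoty z ^ 3 = t / (xdoty z)\<^sup>2"
      using xdoty[OF z] N(7)[rule_format, OF that, symmetric]
      by (simp add: G_def t_def power2_eq_square power3_eq_cube)
    show ?thesis
      unfolding g_eq[OF z] F_metric_eq Let_def normal_metric_inject c
      using xdoty[OF z] pqr by (simp add: field_simps)
  qed
  with N show thesis by (intro that[of N V F]) simp_all
qed

section \<open>Construction of the potential\<close>

definition cone_ratio :: "complex^3 \<Rightarrow> complex^2" where
  "cone_ratio w = vector [w $ 1 / w $ 3, w $ 2 / w $ 3]"

text \<open>\<open>cone_ratio\<close> has degree 0, so \<open>F\<close> contributes nothing to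
  Euler's relation and the factor -3 comes from the cube alone.\<close>

lemma
  fixes F :: "complex^2 \<Rightarrow> complex"
  assumes F: "F holo_on V" and U: "\<And>w. w \<in> U \<Longrightarrow> w $ 3 \<noteq> 0" "\<And>w. w \<in> U \<Longrightarrow> cone_ratio w \<in> V"
  shows holo_on_homogeneous: "(\<lambda>w. F (cone_ratio w) / (w $ 3) ^ 3) holo_on U"
    and homogeneous_euler: "\<And>w. w \<in> U \<Longrightarrow>
      (\<Sum>j\<in>UNIV. w $ j * pd j (\<lambda>w. F (cone_ratio w) / (w $ 3) ^ 3) w) = -3 * (F (cone_ratio w) / (w $ 3) ^ 3)"
proof -
  have "\<forall>j. (\<lambda>w. cone_ratio w $ j) holo_on U"
    unfolding forall_2 cone_ratio_def by (simp add: U holo_intros)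
  then have ratio: "(\<lambda>w. cone_ratio w $ j) holo_on U" for j by simp
  note comp = holo_on_compose[OF F ratio U(2)]
  then show "(\<lambda>w. F (cone_ratio w) / (w $ 3) ^ 3) holo_on U"
    by (intro holo_on_divide holo_on_power holo_on_coord) (simp_all add: U)
  fix w assume w: "w \<in> U"
  have w3: "w $ 3 \<noteq> 0" by (rule U(1)[OF w])
  have "(\<lambda>w. F (cone_ratio w)) holo_on {w}"
    using comp w by (rule holo_on_at)
  then have "pd j (\<lambda>w. F (cone_ratio w) / (w $ 3) ^ 3) w =
      (pd j (\<lambda>w. F (cone_ratio w)) w * (w $ 3) ^ 3 - F (cone_ratio w) * pd j (\<lambda>w. (w $ 3) ^ 3) w) / ((w $ 3) ^ 3)\<^sup>2" for j
    using w3 by (simp add: pd_divide holo_intros)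
  moreover have "pd j (\<lambda>w. F (cone_ratio w)) w = pd 1 F (cone_ratio w) * pd j (\<lambda>w. w $ 1 / w $ 3) w +
      pd 2 F (cone_ratio w) * pd j (\<lambda>w. w $ 2 / w $ 3) w" for j
    using pd_compose[OF F ratio U(2) w] by (simp add: sum_2 cone_ratio_def)
  ultimately show "(\<Sum>j\<in>UNIV. w $ j * pd j (\<lambda>w. F (cone_ratio w) / (w $ 3) ^ 3) w) =
      -3 * (F (cone_ratio w) / (w $ 3) ^ 3)"
    using w3 by (simp add: sum_3 pd_simps holo_intros) (simp add: field_simps eval_nat_numeral)
qed

text \<open>The coefficients of \<open>F_metric\<close> depend on \<open>(x, y)\<close> through this
  map and through \<open>x\<close>. Treating \<open>x\<cdot>y\<close> as an independent third
  variable allows integration in it with \<open>x\<close> fixed.\<close>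

definition cone_coords :: "pt \<Rightarrow> complex^3" where
  "cone_coords z = vector [z $ Inl 1, z $ Inl 2, xdoty z]"

lemma cone_coords_nth [simp]:
  "cone_coords z $ 1 = z $ Inl 1" "cone_coords z $ 2 = z $ Inl 2" "cone_coords z $ 3 = xdoty z"
  by (simp_all add: cone_coords_def)

lemma cone_ratio_cone_coords: "cone_ratio (cone_coords z) = x_ratio z"
  by (simp add: vec_eq_iff forall_2 cone_ratio_def x_ratio_def)

lemma holo_on_cone_coords: "(\<lambda>z. cone_coords z $ j) holo_on U"
proof -
  have "\<forall>j. (\<lambda>z. cone_coords z $ j) holo_on U"
    unfolding forall_3 by (simp add: holo_on_coord holo_on_xdoty)
  then show ?thesis by simp
qed

lemma
  assumes f: "f holo_on B"
  shows holo_on_comp_cone_coords: "(\<lambda>z. f (cone_coords z)) holo_on (cone_coords -` B)"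
    and pd_comp_cone_coords: "\<And>z. cone_coords z \<in> B \<Longrightarrow>
      pd (Inl 1) (\<lambda>z. f (cone_coords z)) z = pd 1 f (cone_coords z) + z $ Inr 2 * pd 3 f (cone_coords z)"
    "\<And>z. cone_coords z \<in> B \<Longrightarrow>
      pd (Inl 2) (\<lambda>z. f (cone_coords z)) z = pd 2 f (cone_coords z) - z $ Inr 1 * pd 3 f (cone_coords z)"
    "\<And>z. cone_coords z \<in> B \<Longrightarrow>
      pd (Inr 1) (\<lambda>z. f (cone_coords z)) z = - z $ Inl 2 * pd 3 f (cone_coords z)"
    "\<And>z. cone_coords z \<in> B \<Longrightarrow>
      pd (Inr 2) (\<lambda>z. f (cone_coords z)) z = z $ Inl 1 * pd 3 f (cone_coords z)"
proof -
  show "(\<lambda>z. f (cone_coords z)) holo_on (cone_coords -` B)"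
    by (rule holo_on_compose[OF f holo_on_cone_coords]) simp
  fix z assume "cone_coords z \<in> B"
  then have "pd k (\<lambda>z. f (cone_coords z)) z = (\<Sum>j\<in>UNIV. pd j f (cone_coords z) * pd k (\<lambda>z. cone_coords z $ j) z)" for k
    using pd_compose[OF f holo_on_cone_coords, of "cone_coords -` B"] by simp
  then show "pd (Inl 1) (\<lambda>z. f (cone_coords z)) z = pd 1 f (cone_coords z) + z $ Inr 2 * pd 3 f (cone_coords z)"
    "pd (Inl 2) (\<lambda>z. f (cone_coords z)) z = pd 2 f (cone_coords z) - z $ Inr 1 * pd 3 f (cone_coords z)"
    "pd (Inr 1) (\<lambda>z. f (cone_coords z)) z = - z $ Inl 2 * pd 3 f (cone_coords z)"
    "pd (Inr 2) (\<lambda>z. f (cone_coords z)) z = z $ Inl 1 * pd 3 f (cone_coords z)"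
    by (simp_all add: sum_3 pd_coord pd_xdoty)
qed

text \<open>A function \<open>\<psi> (x, x \<cdot> y)\<close> with \<open>\<psi>\<^sub>r\<^sub>r = \<Phi>\<close> has the right Hessian. By homogeneity of \<open>\<Phi>\<close> its
  defect in the heavenly equation depends on \<open>x\<close> only, and is cancelled by adding \<open>y\<^sup>1 b (x)\<close>.\<close>

lemma heavenly_potential_exists:
  assumes \<Phi>: "\<Phi> holo_on ball a e"
    and euler: "\<And>w. w \<in> ball a e \<Longrightarrow> (\<Sum>j\<in>UNIV. w $ j * pd j \<Phi> w) = -3 * \<Phi> w"
  defines "N \<equiv> cone_coords -` ball a e"
  obtains \<Theta> where "\<Theta> holo_on N" "\<forall>z\<in>N. second_heavenly \<Theta> z"
    "\<forall>z\<in>N. heavenly_metric \<Theta> z = normal_metric (\<Phi> (cone_coords z) * (z $ Inl 2)\<^sup>2)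
       (- \<Phi> (cone_coords z) * z $ Inl 1 * z $ Inl 2) (\<Phi> (cone_coords z) * (z $ Inl 1)\<^sup>2)"
proof -
  let ?B = "ball a e"
  obtain \<psi>1 where \<psi>1: "\<psi>1 holo_on ?B" "\<And>w. w \<in> ?B \<Longrightarrow> pd 3 \<psi>1 w = \<Phi> w"
    using holo_on_primitive[OF \<Phi>, of 3] by metis
  obtain \<psi> where \<psi>: "\<psi> holo_on ?B" "\<And>w. w \<in> ?B \<Longrightarrow> pd 3 \<psi> w = \<psi>1 w"
    using holo_on_primitive[OF \<psi>1(1), of 3] by metis
  \<comment> \<open>For the potential \<open>\<psi> (x, x\<cdot>y)\<close> the Hessian has
    determinant 0, and the mixed derivatives in the heavenly equation add up to
    \<open>- c\<close>.\<close>
  define c where "c w = 2 * \<psi>1 w + w $ 1 * pd 1 \<psi>1 w + w $ 2 * pd 2 \<psi>1 w + w $ 3 * \<Phi> w" for w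
  note pd\<psi>1 = holo_on_pd[OF open_ball \<psi>1(1)]
  have c: "c holo_on ?B"
    unfolding c_def by (intro holo_intros \<psi>1(1) \<Phi> pd\<psi>1)
  \<comment> \<open>Differentiation turns every \<open>\<psi>1\<close> into \<open>\<Phi>\<close>;
    the result is \<open>3 * \<Phi>\<close> plus the Euler sum, which is
    \<open>-3 * \<Phi>\<close>.\<close>
  have c3: "pd 3 c w = 0" if w: "w \<in> ?B" for w
  proof -
    have comm: "pd 3 (pd j \<psi>1) w = pd j \<Phi> w" for j
      using pd_commute[OF open_ball \<psi>1(1) w, of 3 j] pd_cong_open[OF open_ball w \<psi>1(2), where k = j] by simp
    have "pd 3 c w = 2 * \<Phi> w + w $ 1 * pd 1 \<Phi> w + w $ 2 * pd 2 \<Phi> w + \<Phi> w + w $ 3 * pd 3 \<Phi> w"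
      unfolding c_def
      by (simp add: pd_simps holo_intros holo_on_at[OF \<psi>1(1) w] holo_on_at[OF \<Phi> w] holo_on_at[OF pd\<psi>1 w]
          comm \<psi>1(2)[OF w])
    then show ?thesis using euler[OF w] by (simp add: sum_3 algebra_simps)
  qed
  \<comment> \<open>Integrating \<open>c\<close> in \<open>x2\<close> yields the correction. As
    \<open>b\<close> stays independent of the third variable, \<open>y1 * b\<close> is linear in
    \<open>y\<close> and leaves the Hessian unchanged.\<close>
  obtain b where b: "b holo_on ?B" "\<And>w. w \<in> ?B \<Longrightarrow> pd 2 b w = c w" "\<And>w. w \<in> ?B \<Longrightarrow> pd 3 b w = 0"
  proof (rule holo_on_primitive[OF c, of 2])
    fix g assume "g holo_on ?B" "\<And>z. z \<in> ?B \<Longrightarrow> pd 2 g z = c z"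
      "\<And>j z. j \<noteq> 2 \<Longrightarrow> (\<And>w. w \<in> ?B \<Longrightarrow> pd j c w = 0) \<Longrightarrow> z \<in> ?B \<Longrightarrow> pd j g z = 0"
    with c3 show thesis by (intro that[of g]) simp_all
  qed
  have N: "open N"
    unfolding N_def
    using continuous_open_preimage[OF continuous_on_holo_components[OF holo_on_cone_coords[of _ UNIV]]] by simp
  have mem: "cone_coords z \<in> ?B" if "z \<in> N" for z using that by (simp add: N_def)
  note pullback = holo_on_comp_cone_coords[of _ ?B, folded N_def]
  note pd_pullback = pd_comp_cone_coords[of _ ?B]
  define \<Theta> where "\<Theta> z = \<psi> (cone_coords z) + z $ Inr 1 * b (cone_coords z)" for z
  have \<Theta>: "\<Theta> holo_on N"
    unfolding \<Theta>_def by (intro holo_intros pullback \<psi>(1) b(1))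
  have at: "(\<lambda>z. \<psi> (cone_coords z)) holo_on {z}" "(\<lambda>z. \<psi>1 (cone_coords z)) holo_on {z}"
    "(\<lambda>z. b (cone_coords z)) holo_on {z}" if "z \<in> N" for z
    using pullback \<psi>(1) \<psi>1(1) b(1) holo_on_at[OF _ that] by simp_all
  have y1: "pd (Inr 1) \<Theta> z = - z $ Inl 2 * \<psi>1 (cone_coords z) + b (cone_coords z)"
    and y2: "pd (Inr 2) \<Theta> z = z $ Inl 1 * \<psi>1 (cone_coords z)" if z: "z \<in> N" for z
    unfolding \<Theta>_def
    using pd_pullback[OF \<psi>(1) mem[OF z]] pd_pullback[OF b(1) mem[OF z]] \<psi>(2)[OF mem[OF z]] b(3)[OF mem[OF z]]
    by (simp_all add: pd_simps holo_intros at[OF z])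
  have second: "pd k (pd (Inr 1) \<Theta>) z = pd k (\<lambda>z. - z $ Inl 2 * \<psi>1 (cone_coords z) + b (cone_coords z)) z"
    "pd k (pd (Inr 2) \<Theta>) z = pd k (\<lambda>z. z $ Inl 1 * \<psi>1 (cone_coords z)) z" if z: "z \<in> N" for z k
    using pd_cong_open[OF N z y1, where k = k] pd_cong_open[OF N z y2, where k = k] by simp_all
  have hess: "pd (Inr 1) (pd (Inr 1) \<Theta>) z = \<Phi> (cone_coords z) * (z $ Inl 2)\<^sup>2"
    "pd (Inr 1) (pd (Inr 2) \<Theta>) z = - \<Phi> (cone_coords z) * z $ Inl 1 * z $ Inl 2"
    "pd (Inr 2) (pd (Inr 2) \<Theta>) z = \<Phi> (cone_coords z) * (z $ Inl 1)\<^sup>2"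
    "pd (Inl 2) (pd (Inr 1) \<Theta>) z - pd (Inl 1) (pd (Inr 2) \<Theta>) z = 0" if z: "z \<in> N" for z
    unfolding second[OF z]
    by (simp_all add: pd_simps holo_intros at[OF z] pd_pullback[OF \<psi>1(1) mem[OF z]]
        pd_pullback[OF b(1) mem[OF z]] \<psi>1(2)[OF mem[OF z]] b(2,3)[OF mem[OF z]]
        power2_eq_square c_def xdoty_eq algebra_simps)
  show thesis
  proof (rule that[OF \<Theta>]; rule ballI)
    fix z assume z: "z \<in> N"
    show "second_heavenly \<Theta> z"
      using hess(4)[OF z] unfolding second_heavenly_def hess(1-3)[OF z]
        pd_commute[OF N \<Theta> z, of "Inr 1" "Inl 2"] pd_commute[OF N \<Theta> z, of "Inr 2" "Inl 1"]
      by (simp add: power2_eq_square)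
    show "heavenly_metric \<Theta> z = normal_metric (\<Phi> (cone_coords z) * (z $ Inl 2)\<^sup>2)
       (- \<Phi> (cone_coords z) * z $ Inl 1 * z $ Inl 2) (\<Phi> (cone_coords z) * (z $ Inl 1)\<^sup>2)"
      using heavenly_metric_eq[OF pd_commute[OF N \<Theta> z]] unfolding hess(1-3)[OF z] .
  qed
qed


text \<open>The converse direction up to the hyper-Kaehler property: the potential is built on a
  ball in the cone coordinates and pulled back.\<close>

lemma F_metric_heavenly:
  assumes F: "open V" "F holo_on V" and z0: "xdoty z0 \<noteq> 0" "x_ratio z0 \<in> V"
  obtains N \<Theta> where "open N" "z0 \<in> N" "\<forall>z\<in>N. xdoty z \<noteq> 0" "x_ratio ` N \<subseteq> V" "\<Theta> holo_on N"
    "\<forall>z\<in>N. second_heavenly \<Theta> z" "\<forall>z\<in>N. F_metric F z = heavenly_metric \<Theta> z"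
    "\<forall>z\<in>N. lie_deriv W (F_metric F) z = F_metric F z"
    "\<forall>z\<in>N. apply2 (F_metric F z) (W z) (W z) = 0"
proof -
  define S where "S = {w :: complex^3. w $ 3 \<noteq> 0} \<inter> cone_ratio -` V"
  have "(\<lambda>w. cone_ratio w $ j) holo_on {w. w $ 3 \<noteq> 0}" for j
  proof -
    have "\<forall>j. (\<lambda>w. cone_ratio w $ j) holo_on {w. w $ 3 \<noteq> 0}"
      unfolding forall_2 cone_ratio_def by (auto intro: holo_on_divide holo_on_coord)
    then show ?thesis by simp
  qed
  note ratio = continuous_on_holo_components[OF this]
  have "open ((\<lambda>w :: complex^3. w $ 3) -` (- {0}))"
    using continuous_open_preimage[OF holo_on_continuous_on[OF holo_on_coord], of UNIV "- {0}"]
    by (simp add: open_Compl)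
  then have "open {w :: complex^3. w $ 3 \<noteq> 0}" by (simp add: vimage_def)
  then have "open S"
    unfolding S_def using ratio F(1) by (intro continuous_open_preimage)
  moreover have "cone_coords z0 \<in> S"
    using z0 by (simp add: S_def cone_ratio_cone_coords)
  ultimately obtain e where e: "e > 0" "ball (cone_coords z0) e \<subseteq> S" using openE by blast
  let ?B = "ball (cone_coords z0) e"
  define \<Phi> where "\<Phi> w = F (cone_ratio w) / (w $ 3) ^ 3" for w
  have B: "w $ 3 \<noteq> 0" "cone_ratio w \<in> V" if "w \<in> ?B" for w
    using e(2) that by (auto simp: S_def simp del: mem_ball)
  have \<Phi>: "\<Phi> holo_on ?B"
    unfolding \<Phi>_def by (rule holo_on_homogeneous[OF F(2) B])
  have euler: "(\<Sum>j\<in>UNIV. w $ j * pd j \<Phi> w) = -3 * \<Phi> w" if "w \<in> ?B" for w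
    unfolding \<Phi>_def by (rule homogeneous_euler[OF F(2) B that])
  define N where "N = cone_coords -` ?B"
  obtain \<Theta> where \<Theta>: "\<Theta> holo_on N" "\<forall>z\<in>N. second_heavenly \<Theta> z"
    "\<forall>z\<in>N. heavenly_metric \<Theta> z = normal_metric (\<Phi> (cone_coords z) * (z $ Inl 2)\<^sup>2)
       (- \<Phi> (cone_coords z) * z $ Inl 1 * z $ Inl 2) (\<Phi> (cone_coords z) * (z $ Inl 1)\<^sup>2)"
    unfolding N_def by (rule heavenly_potential_exists[OF \<Phi> euler])
  have mem: "cone_coords z \<in> ?B" if "z \<in> N" for z using that by (simp add: N_def)
  have N: "open N"
    unfolding N_def
    using continuous_open_preimage[OF continuous_on_holo_components[OF holo_on_cone_coords[of _ UNIV]]] by simp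
  have F_eq: "F_metric F z = normal_metric (\<Phi> (cone_coords z) * (z $ Inl 2)\<^sup>2)
       (- \<Phi> (cone_coords z) * z $ Inl 1 * z $ Inl 2) (\<Phi> (cone_coords z) * (z $ Inl 1)\<^sup>2)" for z
    by (simp add: F_metric_eq Let_def \<Phi>_def cone_ratio_cone_coords)
  have N': "xdoty z \<noteq> 0" "x_ratio z \<in> V" if "z \<in> N" for z
    using B[OF mem[OF that]] by (simp_all add: cone_ratio_cone_coords)
  have lie: "lie_deriv W (F_metric F) z = F_metric F z" if z: "z \<in> N" for z
  proof -
    have h: "(\<lambda>z. \<Phi> (cone_coords z)) holo_on {z}"
      using holo_on_comp_cone_coords[OF \<Phi>] z unfolding N_def[symmetric] by (rule holo_on_at)
    \<comment> \<open>All three cone coordinates have degree 1 along \<open>W\<close>, so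
      \<open>W\<close> acts as the Euler field. The two factors of \<open>x\<close> in each
      coefficient then raise the degree from -3 to -1.\<close>
    have "ddW (\<lambda>z. \<Phi> (cone_coords z)) z = -3 * \<Phi> (cone_coords z)"
      using euler[OF mem[OF z]]
      by (simp add: ddW_def pd_comp_cone_coords[OF \<Phi> mem[OF z]] sum_3 xdoty_eq algebra_simps)
    then have D: "z $ Inl 1 * pd (Inl 1) (\<lambda>z. \<Phi> (cone_coords z)) z =
        -3 * \<Phi> (cone_coords z) - z $ Inl 2 * pd (Inl 2) (\<lambda>z. \<Phi> (cone_coords z)) z"
      by (simp add: ddW_def eq_diff_eq)
    have "ddW (\<lambda>z. \<Phi> (cone_coords z) * (z $ Inl 2)\<^sup>2) z = - (\<Phi> (cone_coords z) * (z $ Inl 2)\<^sup>2)"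
      "ddW (\<lambda>z. - \<Phi> (cone_coords z) * z $ Inl 1 * z $ Inl 2) z = \<Phi> (cone_coords z) * z $ Inl 1 * z $ Inl 2"
      "ddW (\<lambda>z. \<Phi> (cone_coords z) * (z $ Inl 1)\<^sup>2) z = - (\<Phi> (cone_coords z) * (z $ Inl 1)\<^sup>2)"
      using D unfolding ddW_def by (simp_all add: pd_simps holo_intros h, algebra+)
    then show ?thesis
      unfolding lie_deriv_normal_metric[OF N z F_eq] by (simp add: F_eq normal_metric_inject)
  qed
  have null: "apply2 (F_metric F z) (W z) (W z) = 0" for z
    by (simp add: F_eq apply2_W_normal_metric power2_eq_square)
  show thesis
    by (rule that[OF N _ _ _ \<Theta>(1,2)])
       (use e \<Theta>(3) N' lie null in \<open>auto simp: F_eq N_def\<close>)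
qed

section \<open>Local normal form and arbitrariness of \<open>F\<close>\<close>

theorem proposition5p4:
  "(\<forall>U \<Theta> g.
      open U \<and> \<Theta> holo_on U
      \<and> complex_hyperkaehler_on g U
      \<and> (\<forall>z\<in>U. g z = heavenly_metric \<Theta> z)
      \<and> (\<forall>z\<in>U. second_heavenly \<Theta> z)
      \<and> (\<forall>z\<in>U. lie_deriv W g z = g z)
      \<and> (\<forall>z\<in>U. apply2 (g z) (W z) (W z) = 0)
      \<longrightarrow> (\<forall>z0\<in>U. xdoty z0 \<noteq> 0 \<longrightarrow>
            (\<exists>N V F. open N \<and> z0 \<in> N \<and> N \<subseteq> U \<and> (\<forall>z\<in>N. xdoty z \<noteq> 0)
               \<and> open V \<and> F holo_on V \<and> x_ratio ` N \<subseteq> V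
               \<and> (\<forall>z\<in>N. g z = F_metric F z))))
   \<and>
   (\<forall>V F. open V \<and> F holo_on V \<longrightarrow>
      (\<forall>z0. xdoty z0 \<noteq> 0 \<and> x_ratio z0 \<in> V \<longrightarrow>
         (\<exists>N \<Theta>. open N \<and> z0 \<in> N \<and> (\<forall>z\<in>N. xdoty z \<noteq> 0) \<and> x_ratio ` N \<subseteq> V
            \<and> \<Theta> holo_on N
            \<and> complex_hyperkaehler_on (F_metric F) N
            \<and> (\<forall>z\<in>N. F_metric F z = heavenly_metric \<Theta> z)
            \<and> (\<forall>z\<in>N. second_heavenly \<Theta> z)
            \<and> (\<forall>z\<in>N. lie_deriv W (F_metric F) z = F_metric F z)
            \<and> (\<forall>z\<in>N. apply2 (F_metric F z) (W z) (W z) = 0))))"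
proof (intro conjI allI impI ballI, goal_cases)
  case (1 U \<Theta> g z0)
  \<comment> \<open>Removing the hypersurface leaves an open set on which the pointwise hypotheses
    persist.\<close>
  define U' where "U' = U \<inter> {z. xdoty z \<noteq> 0}"
  have "open (xdoty -` (- {0}))"
    using continuous_open_preimage[OF holo_on_continuous_on[OF holo_on_xdoty], of UNIV "- {0}"]
    by (simp add: open_Compl)
  then have U': "open U'" using 1 by (simp add: U'_def vimage_def open_Int)
  have sub: "z \<in> U" "xdoty z \<noteq> 0" if "z \<in> U'" for z using that by (simp_all add: U'_def)
  have holo: "\<Theta> holo_on U'" using 1 holo_on_subset[of \<Theta> U U'] by (simp add: U'_def)
  have z0: "z0 \<in> U'" using 1 by (simp add: U'_def)
  have g: "g z = heavenly_metric \<Theta> z" "second_heavenly \<Theta> z" "lie_deriv W g z = g z"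
    "apply2 (g z) (W z) (W z) = 0" if "z \<in> U'" for z
    using 1 sub(1)[OF that] by blast+
  obtain N V F where N: "open N" "z0 \<in> N" "N \<subseteq> U'" "open V" "F holo_on V" "x_ratio ` N \<subseteq> V"
    "\<forall>z\<in>N. g z = F_metric F z"
    by (rule homogeneous_null_heavenly_metric[OF U' holo g sub(2) z0])
  then have "N \<subseteq> U" "\<forall>z\<in>N. xdoty z \<noteq> 0" using sub by auto
  with N show ?case by (intro exI[of _ N] exI[of _ V] exI[of _ F]) simp
next
  case (2 V F z0)
  then obtain N \<Theta> where N: "open N" "z0 \<in> N" "\<forall>z\<in>N. xdoty z \<noteq> 0" "x_ratio ` N \<subseteq> V" "\<Theta> holo_on N"
    "\<forall>z\<in>N. second_heavenly \<Theta> z" "\<forall>z\<in>N. F_metric F z = heavenly_metric \<Theta> z"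
    "\<forall>z\<in>N. lie_deriv W (F_metric F) z = F_metric F z"
    "\<forall>z\<in>N. apply2 (F_metric F z) (W z) (W z) = 0"
    using F_metric_heavenly[of V F z0] by metis
  \<comment> \<open>The potential solves the heavenly equation on \<open>N\<close>, so the explicit
    complex structures apply.\<close>
  moreover have "complex_hyperkaehler_on (F_metric F) N"
    using N by (intro heavenly_hyperkaehler[of N \<Theta>]) simp_all
  ultimately show ?case by (intro exI[of _ N] exI[of _ \<Theta>]) simp
qed

end
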